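(* Let $\mathcal{X}$ be a Hilbert space, let $P$ and $\nu$ be Borel probability measures on $\mathcal{X}$, and let $\kappa_1\colon[0,\infty)\to[0,\infty)$ be continuous and non-increasing with $\kappa_1(0)>0$ and $\lim_{t\to\infty}\kappa_1(t)=0$, and such that $t\mapsto\kappa_1(\sqrt{t})$ is completely monotone. Let $$D_I(x;P)=\int_{\mathcal{X}}\int_{\mathcal{X}}\kappa_1\big(|\langle x,v\rangle_{\mathcal{X}}-\langle y,v\rangle_{\mathcal{X}}|\big)\,dP(y)\,d\nu(v),\qquad x\in\mathcal{X},$$ be the corresponding integrated $h$-depth. Then there exists a Borel probability measure $\mu_1$ on $\mathbb{R}$ whose Fourier transform satisfies $\kappa_1(|s-t|)=\kappa_1(0)\,\widehat{\mu}_1(s-t)$ for all $s,t\in\mathbb{R}$. In addition, let $\mu$ be the distribution on $\mathcal{X}$ of the random element $UV$, where $U\sim\mu_1$ (real-valued) and $V\sim\nu$ ($\mathcal{X}$-valued) are independent, and let $k(x,y)=\widehat{\mu}(x-y)$ for $x,y\in\mathcal{X}$. Then $D_I(x;P)=\kappa_1(0)\,\Phi_kP(x)$ for all $x\in\mathcal{X}$.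
   Context: A function $f\colon[0,\infty)\to[0,\infty)$ is completely monotone if $(-1)^nf^{(n)}(t)\ge 0$ for all $t>0$ and all $n=0,1,2,\dots$. The Fourier transform of a Borel probability measure $\mu$ on a (real) Hilbert space $\mathcal{X}$ is $\widehat{\mu}(x)=\int_{\mathcal{X}}e^{i\langle x,v\rangle_{\mathcal{X}}}\,d\mu(v)$; on $\mathbb{R}$ the inner product is multiplication. A kernel on a set $\mathcal{X}$ is a symmetric function $k\colon\mathcal{X}\times\mathcal{X}\to\mathbb{R}$ that is positive definite, i.e. $\sum_{i,j=1}^{n}a_ia_jk(x_i,x_j)\ge 0$ for all $n$, $a_i\in\mathbb{R}$, $x_i\in\mathcal{X}$; $\mathcal{H}_k$ denotes its reproducing kernel Hilbert space. For a bounded measurable kernel $k$ and a Borel probability measure $P$, the kernel mean embedding is $\Phi_kP=\int_{\mathcal{X}}k(\cdot,y)\,dP(y)\in\mathcal{H}_k$ (Bochner integral), a function from $\mathcal{X}$ to $\mathbb{R}$ with $\Phi_kP(x)=\int_{\mathcal{X}}k(x,y)\,dP(y)$. The integrated $h$-depth $D_I(x;P)$ is the average over $v\sim\nu$ of the one-dimensional $h$-depths $\mathbb{E}\left[\kappa_1(|\langle x,v\rangle_{\mathcal{X}}-\langle X,v\rangle_{\mathcal{X}}|)\right]$, $X\sim P$. *)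

theory Defs
  imports "HOL-Probability.Probability"
begin

definition borel_prob :: "'a::topological_space measure \<Rightarrow> bool" where
  "borel_prob P \<longleftrightarrow> prob_space P \<and> sets P = sets borel"

text \<open>
  Functions on \<open>[0,\<infinity>)\<close> are represented by functions on the whole real line whose values at
  negative arguments are irrelevant. Every iterated derivative is required to exist on
  \<open>(0,\<infinity>)\<close>, since \<^const>\<open>deriv\<close> is total.
\<close>

definition completely_monotone :: "(real \<Rightarrow> real) \<Rightarrow> bool" where
  "completely_monotone f \<longleftrightarrow>
     (\<forall>t\<ge>0. 0 \<le> f t) \<and>
     (\<forall>n. \<forall>t>0. (deriv ^^ n) f field_differentiable (at t) \<and> 0 \<le> (-1) ^ n * (deriv ^^ n) f t)"

definition fourier_transform :: "'a::real_inner measure \<Rightarrow> 'a \<Rightarrow> complex" where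
  "fourier_transform \<mu> x = (CLINT v|\<mu>. exp (\<i> * complex_of_real (x \<bullet> v)))"

definition represented_by :: "(real \<Rightarrow> real) \<Rightarrow> real measure \<Rightarrow> bool" where
  "represented_by \<kappa> \<mu> \<longleftrightarrow>
     borel_prob \<mu> \<and>
     (\<forall>s t. complex_of_real (\<kappa> \<bar>s - t\<bar>) = complex_of_real (\<kappa> 0) * fourier_transform \<mu> (s - t))"

definition integrated_h_depth ::
  "(real \<Rightarrow> real) \<Rightarrow> 'a::real_inner measure \<Rightarrow> 'a measure \<Rightarrow> 'a \<Rightarrow> real" where
  "integrated_h_depth \<kappa> \<nu> P x = (\<integral>v. (\<integral>y. \<kappa> \<bar>x \<bullet> v - y \<bullet> v\<bar> \<partial>P) \<partial>\<nu>)"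

text \<open>
  The library's \<^const>\<open>prob_space.indep_var\<close> forces both random variables to have the same type.
\<close>

definition indep_rvs ::
  "'w measure \<Rightarrow> ('w \<Rightarrow> 'b::topological_space) \<Rightarrow> ('w \<Rightarrow> 'c::topological_space) \<Rightarrow> bool" where
  "indep_rvs M U V \<longleftrightarrow>
     U \<in> borel_measurable M \<and> V \<in> borel_measurable M \<and>
     prob_space.indep_set M {U -` A \<inter> space M | A. A \<in> sets borel}
                            {V -` B \<inter> space M | B. B \<in> sets borel}"

definition is_kernel :: "('x \<Rightarrow> 'x \<Rightarrow> real) \<Rightarrow> bool" where
  "is_kernel k \<longleftrightarrow>
     (\<forall>x y. k x y = k y x) \<and>
     (\<forall>(n::nat) (a::nat \<Rightarrow> real) (x::nat \<Rightarrow> 'x).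
        0 \<le> (\<Sum>i<n. \<Sum>j<n. a i * a j * k (x i) (x j)))"

definition bounded_measurable_kernel :: "('x::topological_space \<Rightarrow> 'x \<Rightarrow> real) \<Rightarrow> bool" where
  "bounded_measurable_kernel k \<longleftrightarrow>
     is_kernel k \<and> (\<exists>C. \<forall>x y. \<bar>k x y\<bar> \<le> C) \<and>
     (\<lambda>(x, y). k x y) \<in> borel_measurable (borel \<Otimes>\<^sub>M borel)"

text \<open>
  A Hilbert space of real functions is given by its carrier \<open>H\<close> and its inner product \<open>ip\<close>
  (only the values of \<open>ip\<close> on \<open>H\<close> matter); the vector space operations are pointwise.
\<close>

definition fnorm :: "(('x \<Rightarrow> real) \<Rightarrow> ('x \<Rightarrow> real) \<Rightarrow> real) \<Rightarrow> ('x \<Rightarrow> real) \<Rightarrow> real" where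
  "fnorm ip f = sqrt (ip f f)"

definition fdist ::
  "(('x \<Rightarrow> real) \<Rightarrow> ('x \<Rightarrow> real) \<Rightarrow> real) \<Rightarrow> ('x \<Rightarrow> real) \<Rightarrow> ('x \<Rightarrow> real) \<Rightarrow> real" where
  "fdist ip f g = fnorm ip (\<lambda>x. f x - g x)"

definition function_hilbert_space ::
  "('x \<Rightarrow> real) set \<Rightarrow> (('x \<Rightarrow> real) \<Rightarrow> ('x \<Rightarrow> real) \<Rightarrow> real) \<Rightarrow> bool" where
  "function_hilbert_space H ip \<longleftrightarrow>
     (\<lambda>x. 0) \<in> H \<and>
     (\<forall>f\<in>H. \<forall>g\<in>H. (\<lambda>x. f x + g x) \<in> H) \<and>
     (\<forall>c. \<forall>f\<in>H. (\<lambda>x. c * f x) \<in> H) \<and>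
     (\<forall>f\<in>H. \<forall>g\<in>H. ip f g = ip g f) \<and>
     (\<forall>f\<in>H. \<forall>g\<in>H. \<forall>h\<in>H. ip (\<lambda>x. f x + g x) h = ip f h + ip g h) \<and>
     (\<forall>c. \<forall>f\<in>H. \<forall>g\<in>H. ip (\<lambda>x. c * f x) g = c * ip f g) \<and>
     (\<forall>f\<in>H. 0 \<le> ip f f \<and> (ip f f = 0 \<longrightarrow> f = (\<lambda>x. 0))) \<and>
     (\<forall>s::nat \<Rightarrow> 'x \<Rightarrow> real.
        range s \<subseteq> H \<longrightarrow>
        (\<forall>e>0. \<exists>N. \<forall>m\<ge>N. \<forall>n\<ge>N. fdist ip (s m) (s n) < e) \<longrightarrow>
        (\<exists>f\<in>H. (\<lambda>n. fdist ip (s n) f) \<longlonglongrightarrow> 0))"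

definition is_rkhs ::
  "('x \<Rightarrow> 'x \<Rightarrow> real) \<Rightarrow> ('x \<Rightarrow> real) set \<Rightarrow> (('x \<Rightarrow> real) \<Rightarrow> ('x \<Rightarrow> real) \<Rightarrow> real) \<Rightarrow> bool" where
  "is_rkhs k H ip \<longleftrightarrow>
     function_hilbert_space H ip \<and>
     (\<forall>y. (\<lambda>x. k x y) \<in> H) \<and>
     (\<forall>f\<in>H. \<forall>y. f y = ip f (\<lambda>x. k x y))"

text \<open>
  Bochner integration with values in the Hilbert space \<open>(H, ip)\<close>. The library's
  \<^const>\<open>has_bochner_integral\<close> takes values in a type and so does not apply to a carrier set
  depending on a kernel; the definition below follows it. Strong measurability of the integrand
  is implied by the \<open>L\<^sup>1\<close>-approximation by simple functions.
\<close>

definition simple_integrable_in ::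
  "('x \<Rightarrow> real) set \<Rightarrow> 'w measure \<Rightarrow> ('w \<Rightarrow> 'x \<Rightarrow> real) \<Rightarrow> bool" where
  "simple_integrable_in H M s \<longleftrightarrow>
     s ` space M \<subseteq> H \<and> simple_function M s \<and>
     emeasure M {w \<in> space M. s w \<noteq> (\<lambda>x. 0)} \<noteq> \<infinity>"

definition simple_integral_in :: "'w measure \<Rightarrow> ('w \<Rightarrow> 'x \<Rightarrow> real) \<Rightarrow> 'x \<Rightarrow> real" where
  "simple_integral_in M s = (\<lambda>x. \<Sum>h\<in>s ` space M. measure M {w \<in> space M. s w = h} * h x)"

definition has_bochner_integral_in ::
  "('x \<Rightarrow> real) set \<Rightarrow> (('x \<Rightarrow> real) \<Rightarrow> ('x \<Rightarrow> real) \<Rightarrow> real) \<Rightarrow>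
   'w measure \<Rightarrow> ('w \<Rightarrow> 'x \<Rightarrow> real) \<Rightarrow> ('x \<Rightarrow> real) \<Rightarrow> bool" where
  "has_bochner_integral_in H ip M F \<Phi> \<longleftrightarrow>
     F ` space M \<subseteq> H \<and> \<Phi> \<in> H \<and>
     (\<exists>s::nat \<Rightarrow> 'w \<Rightarrow> 'x \<Rightarrow> real.
        (\<forall>n. simple_integrable_in H M (s n)) \<and>
        (\<forall>n. (\<lambda>w. fdist ip (F w) (s n w)) \<in> borel_measurable M) \<and>
        (\<lambda>n. \<integral>\<^sup>+ w. ennreal (fdist ip (F w) (s n w)) \<partial>M) \<longlonglongrightarrow> 0 \<and>
        (\<lambda>n. fdist ip (simple_integral_in M (s n)) \<Phi>) \<longlonglongrightarrow> 0)"

text \<open>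
  By the Moore-Aronszajn theorem a kernel has exactly one reproducing kernel Hilbert space, so
  the existential quantifier selects it.
\<close>

definition is_kernel_mean_embedding ::
  "('x \<Rightarrow> 'x \<Rightarrow> real) \<Rightarrow> 'x measure \<Rightarrow> ('x \<Rightarrow> real) \<Rightarrow> bool" where
  "is_kernel_mean_embedding k P \<Phi> \<longleftrightarrow>
     (\<exists>H ip. is_rkhs k H ip \<and> has_bochner_integral_in H ip P (\<lambda>y x. k x y) \<Phi>)"

end

theory Submission
  imports Defs "HOL-Real_Asymp.Real_Asymp"
begin

text \<open>
  By Bernstein's theorem \<open>\<kappa>\<^sub>1 (sqrt t) / \<kappa>\<^sub>1 0\<close> is the Laplace transform of a probability measure
  on \<open>[0,\<infinity>)\<close>. Since \<open>exp (- s\<^sup>2 u)\<close> is the characteristic function of \<open>sqrt (2 u) Z\<close> for a standard normal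
  variable \<open>Z\<close>, the corresponding mixture of Gaussians is \<open>\<mu>\<^sub>1\<close>. Independence of \<open>U\<close> and \<open>V\<close> gives
  \<open>\<kappa>\<^sub>1 0 * k x y = \<integral> \<kappa>\<^sub>1 \<bar>x \<bullet> v - y \<bullet> v\<bar> d\<nu> v\<close>, and integrating over \<open>y\<close> yields the depth after an exchange
  of integrals.

  As the Hilbert space may be nonseparable, neither that exchange nor the measurability of \<open>k\<close> nor the
  Bochner integrability of \<open>y \<mapsto> k(\<cdot>, y)\<close> is automatic. All three follow from simple functions \<open>\<tau>\<^sub>n\<close>
  with \<open>\<tau>\<^sub>n y \<bullet> v \<rightarrow> y \<bullet> v\<close> for every \<open>y\<close> and \<open>\<nu>\<close>-almost every \<open>v\<close>, and for every \<open>v\<close> and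
  \<open>P\<close>-almost every \<open>y\<close>; they exist because a suitably weighted covariance form of a probability measure
  is trace class.
\<close>

section \<open>Completely monotone functions\<close>

lemma cm_deriv:
  assumes "completely_monotone g" "0 < t"
  shows "((deriv ^^ n) g has_real_derivative (deriv ^^ Suc n) g t) (at t)"
  using assms unfolding completely_monotone_def
  by (auto simp: field_differentiable_derivI)

lemma cm_sign:
  assumes "completely_monotone g" "0 < t"
  shows "0 \<le> (-1) ^ n * (deriv ^^ n) g t"
  using assms unfolding completely_monotone_def by auto

lemma cm_antimono:
  assumes g: "completely_monotone g" and st: "0 < s" "s \<le> t"
  shows "(-1) ^ n * (deriv ^^ n) g t \<le> (-1) ^ n * (deriv ^^ n) g s"
proof (rule DERIV_nonpos_imp_nonincreasing[OF st(2)])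
  fix x assume "s \<le> x" "x \<le> t"
  hence x: "0 < x" using st by simp
  show "\<exists>y. ((\<lambda>x. (-1) ^ n * (deriv ^^ n) g x) has_real_derivative y) (at x) \<and> y \<le> 0"
    using DERIV_cmult[OF cm_deriv[OF g x, of n], of "(-1) ^ n"] cm_sign[OF g x, of "Suc n"]
    by (intro exI conjI) (assumption, simp)
qed

text \<open>
  For \<open>h y = g (l - y)\<close>, whose derivatives are all nonnegative and increasing, the \<open>n\<close>-th Taylor
  remainders at \<open>c * R\<close> and \<open>R\<close> satisfy \<open>r\<^sub>n (c * R) \<le> c ^ n * r\<^sub>n R \<le> c ^ n * h R\<close>. The first inequality is
  Maclaurin's formula for \<open>y \<mapsto> c ^ n * h y - h (c * y)\<close>.
\<close>

lemma cm_power_series: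
  assumes g: "completely_monotone g" and l: "0 < l" and s: "0 < s" "s < 1"
  shows "(\<lambda>n. (-1) ^ n * (deriv ^^ n) g l / fact n * l ^ n * s ^ n) sums g (l - l * s)"
proof -
  define a where "a n = (-1) ^ n * (deriv ^^ n) g l / fact n" for n
  \<comment> \<open>\<open>R\<close> is the midpoint of \<open>l * s\<close> and \<open>l\<close>,
    and \<open>c < 1\<close> is the ratio of \<open>l * s\<close> to \<open>R\<close>, so the
    remainder at \<open>l * s\<close> is compared with a value at a point still below
    \<open>l\<close>.\<close>
  define R where "R = l * (1 + s) / 2"
  define c where "c = 2 * s / (1 + s)"
  have R: "0 < R" "R < l" using l s mult_strict_left_mono[of s 1 l] by (auto simp: R_def field_simps intro!: add_pos_pos)
  have c: "0 < c" "c < 1" using s by (auto simp: c_def field_simps)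
  have cR: "c * R = l * s" using s by (simp add: c_def R_def field_simps)
  have a: "0 \<le> a n" for n using cm_sign[OF g l, of n] by (simp add: a_def)
  \<comment> \<open>The factor \<open>b\<close> allows both uses: \<open>b = 1\<close> for the
    expansion of \<open>g (l - y)\<close> and \<open>b = c\<close> for the dilated function
    \<open>g (l - c * y)\<close>.\<close>
  have shift: "((\<lambda>y. (-1) ^ n * (deriv ^^ n) g (l - b * y)) has_real_derivative
      b * ((-1) ^ Suc n * (deriv ^^ Suc n) g (l - b * y))) (at y)" if "b * y < l" for b y n
  proof -
    have "((\<lambda>y. (deriv ^^ n) g (l - b * y)) has_real_derivative
        (deriv ^^ Suc n) g (l - b * y) * (- b)) (at y)"
      using that by (intro DERIV_chain2[OF cm_deriv[OF g]]) (auto intro!: derivative_eq_intros)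
    from DERIV_cmult[OF this, of "(-1) ^ n"] show ?thesis by (simp add: algebra_simps)
  qed
  \<comment> \<open>The Maclaurin remainder is a signed derivative of \<open>g\<close> at a positive
    point times positive factors, hence nonnegative.\<close>
  have lower: "(\<Sum>m<n. a m * (l * s) ^ m) \<le> g (l - l * s)" if n: "0 < n" for n
  proof -
    have ls: "0 < l * s" "l * s < l" using l s by auto
    have "\<exists>t>0. t < l * s \<and> g (l - 1 * (l * s)) =
        (\<Sum>m<n. (-1) ^ m * (deriv ^^ m) g (l - 1 * 0) / fact m * (l * s) ^ m) +
        (-1) ^ n * (deriv ^^ n) g (l - 1 * t) / fact n * (l * s) ^ n"
    proof (rule Maclaurin[OF ls(1) n])
      show "\<forall>m t. m < n \<and> 0 \<le> t \<and> t \<le> l * s \<longrightarrow>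
        ((\<lambda>y. (-1) ^ m * (deriv ^^ m) g (l - 1 * y)) has_real_derivative
          (-1) ^ Suc m * (deriv ^^ Suc m) g (l - 1 * t)) (at t)"
        using shift[where b = 1] ls by auto
    qed auto
    then obtain t where "0 < t" "t < l * s" and eq: "g (l - l * s) =
        (\<Sum>m<n. a m * (l * s) ^ m) + (-1) ^ n * (deriv ^^ n) g (l - t) / fact n * (l * s) ^ n"
      by (auto simp: a_def)
    moreover have "0 \<le> (-1) ^ n * (deriv ^^ n) g (l - t)"
      using \<open>t < l * s\<close> ls by (intro cm_sign[OF g]) auto
    ultimately show ?thesis using ls by (simp add: eq)
  qed
  have upper: "g (l - l * s) - (\<Sum>m<n. a m * (l * s) ^ m) \<le> c ^ n * g (l - R)" if n: "0 < n" for n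
  proof -
    let ?d = "\<lambda>m y. c ^ n * ((-1) ^ m * (deriv ^^ m) g (l - 1 * y)) -
                    c ^ m * ((-1) ^ m * (deriv ^^ m) g (l - c * y))"
    have "\<exists>t>0. t < R \<and> c ^ n * g (l - 1 * R) - g (l - c * R) =
        (\<Sum>m<n. ?d m 0 / fact m * R ^ m) + ?d n t / fact n * R ^ n"
    proof (rule Maclaurin[OF R(1) n])
      show "\<forall>m t. m < n \<and> 0 \<le> t \<and> t \<le> R \<longrightarrow> (?d m has_real_derivative ?d (Suc m) t) (at t)"
      proof (intro allI impI)
        fix m t assume t: "m < n \<and> 0 \<le> t \<and> t \<le> R"
        have "c * t \<le> 1 * t" using t c by (intro mult_right_mono) auto
        hence *: "1 * t < l" "c * t < l" using t R by auto
        show "(?d m has_real_derivative ?d (Suc m) t) (at t)"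
          using DERIV_diff[OF DERIV_cmult[OF shift[OF *(1), of m], of "c ^ n"]
              DERIV_cmult[OF shift[OF *(2), of m], of "c ^ m"]]
          by (simp add: algebra_simps)
      qed
    qed auto
    then obtain t where t: "0 < t" "t < R" and eq: "c ^ n * g (l - R) - g (l - l * s) =
        (\<Sum>m<n. ?d m 0 / fact m * R ^ m) + ?d n t / fact n * R ^ n"
      by (auto simp: cR)
    \<comment> \<open>At \<open>m = n\<close> both terms of \<open>?d\<close> carry the factor
      \<open>c ^ n\<close>. As \<open>l - t \<le> l - c * t\<close>, monotonicity of the signed
      derivative makes the remainder nonnegative.\<close>
    have "c * t \<le> 1 * t" using t c by (intro mult_right_mono) auto
    hence "(-1) ^ n * (deriv ^^ n) g (l - c * t) \<le> (-1) ^ n * (deriv ^^ n) g (l - t)"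
      using t R by (intro cm_antimono[OF g]) auto
    hence "c ^ n * ((-1) ^ n * (deriv ^^ n) g (l - c * t)) \<le> c ^ n * ((-1) ^ n * (deriv ^^ n) g (l - t))"
      by (rule mult_left_mono) (use c in simp)
    hence "0 \<le> ?d n t / fact n * R ^ n" using R
      by (intro mult_nonneg_nonneg divide_nonneg_nonneg) auto
    moreover have "(\<Sum>m<n. ?d m 0 / fact m * R ^ m) =
        (\<Sum>m<n. c ^ n * (a m * R ^ m)) - (\<Sum>m<n. a m * (l * s) ^ m)"
      unfolding sum_subtractf[symmetric]
    proof (intro sum.cong refl)
      have "(c ^ n * b - c ^ m * b) / fact m * R ^ m = c ^ n * (b / fact m * R ^ m) - b / fact m * (c * R) ^ m"
        for b :: real and m by (simp add: power_mult_distrib field_simps)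
      from this[of "(-1) ^ m * (deriv ^^ m) g l" for m]
      show "?d m 0 / fact m * R ^ m = c ^ n * (a m * R ^ m) - a m * (l * s) ^ m" for m
        unfolding cR a_def by simp
    qed
    moreover have "0 \<le> (\<Sum>m<n. c ^ n * (a m * R ^ m))"
      using a c R by (intro sum_nonneg mult_nonneg_nonneg) auto
    ultimately show ?thesis using eq by linarith
  qed
  have "(\<lambda>n. \<Sum>m<n. a m * (l * s) ^ m) \<longlonglongrightarrow> g (l - l * s)"
  proof (rule tendsto_sandwich)
    show "\<forall>\<^sub>F n in sequentially. g (l - l * s) - c ^ n * g (l - R) \<le> (\<Sum>m<n. a m * (l * s) ^ m)"
      using eventually_gt_at_top[of 0]
    proof eventually_elim
      case (elim n)
      thus ?case using upper[OF elim] by linarith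
    qed
    show "\<forall>\<^sub>F n in sequentially. (\<Sum>m<n. a m * (l * s) ^ m) \<le> g (l - l * s)"
      using eventually_gt_at_top[of 0] by eventually_elim (rule lower)
    have "(\<lambda>n. g (l - l * s) - c ^ n * g (l - R)) \<longlonglongrightarrow> g (l - l * s) - 0 * g (l - R)"
      using c by (intro tendsto_intros LIMSEQ_power_zero) auto
    thus "(\<lambda>n. g (l - l * s) - c ^ n * g (l - R)) \<longlonglongrightarrow> g (l - l * s)" by simp
  qed auto
  thus ?thesis by (simp add: sums_def a_def power_mult_distrib mult.assoc)
qed

text \<open>The case \<open>s = 1\<close> of \<open>cm_power_series\<close>, by letting
  \<open>s\<close> increase to 1. The coefficients are nonnegative, so the partial sums stay below
  the limit \<open>g 0\<close> of the series, and the series stays below the full coefficient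
  sum.\<close>

lemma cm_coefficient_sum:
  assumes g: "completely_monotone g" and cont: "continuous_on {0..} g" and l: "0 < l"
  shows "(\<lambda>n. (-1) ^ n * (deriv ^^ n) g l / fact n * l ^ n) sums g 0"
proof -
  define p where "p n = (-1) ^ n * (deriv ^^ n) g l / fact n * l ^ n" for n
  have p: "0 \<le> p n" for n using cm_sign[OF g l, of n] l by (simp add: p_def)
  have ser: "(\<lambda>n. p n * s ^ n) sums g (l - l * s)" if "0 < s" "s < 1" for s
    using cm_power_series[OF g l that] by (simp add: p_def)
  have ev: "\<forall>\<^sub>F s in at_left 1. 0 < s \<and> s < (1::real)"
    using eventually_at_left_real[of 0 "1::real"] by (auto elim: eventually_mono)
  have lim: "((\<lambda>s. g (l - l * s)) \<longlongrightarrow> g 0) (at_left 1)"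
  proof (rule continuous_on_tendsto_compose[OF cont])
    have "((\<lambda>s. l - l * s) \<longlongrightarrow> l - l * 1) (at_left 1)" by (intro tendsto_intros)
    thus "((\<lambda>s. l - l * s) \<longlongrightarrow> 0) (at_left 1)" by simp
    show "\<forall>\<^sub>F s in at_left 1. l - l * s \<in> {0..}"
      using ev by eventually_elim (use l in auto)
  qed auto
  have part: "(\<Sum>n<N. p n) \<le> g 0" for N
  proof -
    have "((\<lambda>s. \<Sum>n<N. p n * s ^ n) \<longlongrightarrow> (\<Sum>n<N. p n * 1 ^ n)) (at_left 1)"
      by (intro tendsto_intros)
    from lim this have "(\<Sum>n<N. p n * 1 ^ n) \<le> g 0"
    proof (rule tendsto_le[rotated])
      show "\<forall>\<^sub>F s in at_left 1. (\<Sum>n<N. p n * s ^ n) \<le> g (l - l * s)"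
        using ev
      proof eventually_elim
        case (elim s)
        have "(\<Sum>n<N. p n * s ^ n) \<le> (\<Sum>n. p n * s ^ n)"
          using p elim ser[of s] by (intro sum_le_suminf) (auto simp: sums_iff)
        thus ?case using ser[of s] elim by (simp add: sums_iff)
      qed
    qed simp
    thus ?thesis by simp
  qed
  have sm: "summable p" by (rule summableI_nonneg_bounded[OF p part])
  have "suminf p \<le> g 0" using sm part by (intro suminf_le_const)
  moreover have "g 0 \<le> suminf p"
  proof (rule tendsto_upperbound[OF lim])
    show "\<forall>\<^sub>F s in at_left 1. g (l - l * s) \<le> suminf p"
      using ev
    proof eventually_elim
      case (elim s)
      have "(\<Sum>n. p n * s ^ n) \<le> suminf p"
      proof (rule suminf_le[OF _ _ sm])
        show "p n * s ^ n \<le> p n" for n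
          using elim p[of n] by (intro mult_left_le power_le_one) auto
      qed (use ser elim in \<open>auto simp: sums_iff\<close>)
      thus ?case using ser[of s] elim by (simp add: sums_iff)
    qed
  qed simp
  ultimately show ?thesis using sm unfolding p_def by (simp add: sums_iff)
qed

section \<open>Laplace transforms and Bernstein's theorem\<close>

lemma lattice_distribution:
  fixes p :: "nat \<Rightarrow> real" and r :: "nat \<Rightarrow> real"
  assumes p: "\<And>k. 0 \<le> p k" and sums: "p sums 1"
  obtains M where "real_distribution M" "\<And>f::real \<Rightarrow> real. f \<in> borel_measurable borel \<Longrightarrow>
    (\<And>x. \<bar>f x\<bar> \<le> 1) \<Longrightarrow> (\<lambda>k. p k * f (r k)) sums (\<integral>x. f x \<partial>M)"
proof
  let ?D = "density (count_space UNIV) (\<lambda>k. ennreal (p k))"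
  let ?M = "distr ?D borel r"
  have "emeasure ?D (space ?D) = 1"
    using p sums by (simp add: emeasure_density nn_integral_count_space_nat suminf_ennreal2 sums_iff)
  then interpret D: prob_space ?D by (rule prob_spaceI)
  have [measurable]: "r \<in> measurable ?D borel" by simp
  interpret M: prob_space ?M by (rule D.prob_space_distr) simp
  show "real_distribution ?M"
    by (intro real_distribution.intro real_distribution_axioms.intro M.prob_space_axioms) auto
  fix f :: "real \<Rightarrow> real" assume [measurable]: "f \<in> borel_measurable borel" and f: "\<And>x. \<bar>f x\<bar> \<le> 1"
  have "(\<integral>x. f x \<partial>?M) = (\<integral>k. f (r k) \<partial>?D)" by (subst integral_distr) auto
  also have "\<dots> = (\<integral>k. p k * f (r k) \<partial>count_space UNIV)" using p by (subst integral_density) auto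
  finally have eq: "(\<integral>x. f x \<partial>?M) = (\<integral>k. p k * f (r k) \<partial>count_space UNIV)" .
  have "summable (\<lambda>k. norm (p k * f (r k)))"
  proof (rule summable_comparison_test')
    show "summable p" using sums by (simp add: sums_iff)
    show "norm (norm (p k * f (r k))) \<le> p k" if "0 \<le> k" for k
      using p[of k] mult_left_mono[OF f[of "r k"] p[of k]] by (simp add: abs_mult)
  qed
  hence "integrable (count_space UNIV) (\<lambda>k. p k * f (r k))" by (simp add: integrable_count_space_nat_iff)
  from sums_integral_count_space_nat[OF this]
  show "(\<lambda>k. p k * f (r k)) sums (\<integral>x. f x \<partial>?M)" by (simp add: eq)
qed

text \<open>The normalised Taylor coefficients of \<open>g\<close> at \<open>l\<close> become point
  masses at \<open>k / l\<close>. Substituting \<open>s = exp (- t / l)\<close> in the power series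
  turns \<open>s ^ k\<close> into the Laplace kernel at \<open>k / l\<close>. Writing
  \<open>max u 0\<close> keeps the integrand bounded by 1 on the whole line.\<close>

lemma cm_laplace_approx:
  assumes g: "completely_monotone g" and cont: "continuous_on {0..} g" and g0: "0 < g 0" and l: "0 < l"
  obtains M where "real_distribution M"
    "\<And>t. 0 < t \<Longrightarrow> (\<integral>u. exp (- t * max u 0) \<partial>M) = g (l * (1 - exp (- t / l))) / g 0"
proof -
  define p where "p n = (-1) ^ n * (deriv ^^ n) g l / fact n * l ^ n / g 0" for n
  have p: "0 \<le> p n" for n using cm_sign[OF g l, of n] l g0 by (simp add: p_def)
  have "p sums 1" unfolding p_def using sums_divide[OF cm_coefficient_sum[OF g cont l], of "g 0"] g0 by simp
  then obtain M where M: "real_distribution M" "\<And>f::real \<Rightarrow> real. f \<in> borel_measurable borel \<Longrightarrow>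
      (\<And>x. \<bar>f x\<bar> \<le> 1) \<Longrightarrow> (\<lambda>k. p k * f (real k / l)) sums (\<integral>x. f x \<partial>M)"
    using lattice_distribution[of p "\<lambda>k. real k / l"] p by blast
  show ?thesis
  proof
    fix t :: real assume t: "0 < t"
    have "(\<lambda>k. p k * exp (- t * max (real k / l) 0)) sums (\<integral>u. exp (- t * max u 0) \<partial>M)"
      by (rule M(2)) (use t in auto)
    moreover have "exp (- t * max (real k / l) 0) = exp (- t / l) ^ k" for k
      using l by (simp add: max_absorb1 exp_of_nat_mult[symmetric] algebra_simps)
    ultimately have "(\<lambda>k. p k * exp (- t / l) ^ k) sums (\<integral>u. exp (- t * max u 0) \<partial>M)" by simp
    moreover have "(\<lambda>k. p k * exp (- t / l) ^ k) sums (g (l - l * exp (- t / l)) / g 0)"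
      using sums_divide[OF cm_power_series[OF g l, of "exp (- t / l)"], of "g 0"] t l
      by (simp add: p_def)
    ultimately show "(\<integral>u. exp (- t * max u 0) \<partial>M) = g (l * (1 - exp (- t / l))) / g 0"
      by (simp add: sums_unique2 right_diff_distrib)
  qed fact
qed

text \<open>
  By \<open>cm_laplace_approx\<close> the function \<open>\<lambda>t. g (l * (1 - exp (- t / l)))\<close> is a Laplace transform;
  let \<open>l \<rightarrow> \<infinity>\<close> and use Helly's theorem.
\<close>

theorem bernstein:
  assumes g: "completely_monotone g" and cont: "continuous_on {0..} g" and g0: "0 < g 0"
  obtains M where "real_distribution M" "AE u in M. 0 \<le> u"
    "\<And>t. 0 \<le> t \<Longrightarrow> g t = g 0 * (\<integral>u. exp (- t * u) \<partial>M)"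
proof -
  have "\<exists>M. real_distribution M \<and> (\<forall>t>0. (\<integral>u. exp (- t * max u 0) \<partial>M) =
      g (real (Suc n) * (1 - exp (- t / real (Suc n)))) / g 0)" for n
    using cm_laplace_approx[OF g cont g0, of "real (Suc n)"] by (metis of_nat_0_less_iff zero_less_Suc)
  then obtain \<mu> where \<mu>: "\<And>n. real_distribution (\<mu> n)" and L: "\<And>n t. 0 < t \<Longrightarrow>
      (\<integral>u. exp (- t * max u 0) \<partial>\<mu> n) = g (real (Suc n) * (1 - exp (- t / real (Suc n)))) / g 0"
    by metis
  interpret \<mu>: real_distribution "\<mu> n" for n by (rule \<mu>)
  \<comment> \<open>Moving all mass to the half-line makes the lower tail trivial in the tightness
    proof and leaves the integrals of \<open>exp (- t * max u 0)\<close> unchanged.\<close>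
  define \<rho> where "\<rho> n = distr (\<mu> n) borel (\<lambda>u. max u 0)" for n
  have \<rho>d: "real_distribution (\<rho> n)" for n
    unfolding \<rho>_def by (rule \<mu>.real_distribution_distr) measurable
  interpret \<rho>: real_distribution "\<rho> n" for n by (rule \<rho>d)
  have L\<rho>: "(\<integral>u. exp (- t * max u 0) \<partial>\<rho> n) = g (real (Suc n) * (1 - exp (- t / real (Suc n)))) / g 0"
    if "0 < t" for t n
    using L[OF that] unfolding \<rho>_def by (subst integral_distr) auto
  \<comment> \<open>Since \<open>l * (1 - exp (- t / l)) \<le> t\<close> and \<open>g\<close>
    decreases, every approximant dominates the target. This is what makes the tail bound uniform in
    \<open>n\<close>.\<close>
  have L_ge: "g t / g 0 \<le> (\<integral>u. exp (- t * max u 0) \<partial>\<rho> n)" if t: "0 < t" for t n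
  proof -
    define l where "l = real (Suc n)"
    have l: "0 < l" by (simp add: l_def)
    have "1 - exp (- t / l) \<le> t / l" using exp_ge_add_one_self[of "- t / l"] by simp
    hence "l * (1 - exp (- t / l)) \<le> l * (t / l)" using l by (intro mult_left_mono) auto
    hence "l * (1 - exp (- t / l)) \<le> t" using l by simp
    moreover have "0 < l * (1 - exp (- t / l))" using t l by auto
    ultimately have "g t \<le> g (l * (1 - exp (- t / l)))" using cm_antimono[OF g, of _ t 0] by simp
    thus ?thesis using g0 unfolding L\<rho>[OF t] l_def by (simp add: divide_right_mono)
  qed
  have \<rho>neg: "measure (\<rho> n) {..-1} = 0" for n
    unfolding \<rho>_def by (subst measure_distr) (auto simp: vimage_def)
  \<comment> \<open>A Markov bound: beyond \<open>K\<close> the function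
    \<open>1 - exp (- u / K)\<close> is at least \<open>1 / 2\<close>, and its integral is at most a
    defect that vanishes for large \<open>K\<close> by continuity of \<open>g\<close> at 0.\<close>
  have tail: "(1 / 2) * measure (\<rho> n) {K<..} \<le> 1 - g (1 / K) / g 0" if K: "0 < K" for n K
  proof -
    let ?f = "\<lambda>u. 1 - exp (- (1 / K) * max u 0)"
    have f_int: "integrable (\<rho> n) (\<lambda>u. exp (- (1 / K) * max u 0))"
      by (rule \<rho>.integrable_const_bound[where B = 1]) (use K in auto)
    have "(1 / 2) * measure (\<rho> n) {K<..} = (\<integral>u. (1 / 2) * indicator {K<..} u \<partial>\<rho> n)" by simp
    also have "\<dots> \<le> (\<integral>u. ?f u \<partial>\<rho> n)"
    proof (rule integral_mono)
      show "integrable (\<rho> n) ?f" using f_int by simp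
      fix u
      show "(1 / 2) * indicator {K<..} u \<le> ?f u"
      proof (cases "K < u")
        case True
        hence "1 \<le> 1 / K * max u 0" using K by (simp add: field_simps)
        hence "exp (- (1 / K) * max u 0) \<le> exp (-1)" by simp
        also have "exp (-1::real) \<le> 1 / 2" using exp_ge_add_one_self[of 1] by (simp add: exp_minus field_simps)
        finally show ?thesis using True by simp
      qed (use K in simp)
    qed (simp add: \<rho>.emeasure_finite less_top[symmetric])
    also have "\<dots> = 1 - (\<integral>u. exp (- (1 / K) * max u 0) \<partial>\<rho> n)"
      using f_int \<rho>.prob_space[of n] by (subst Bochner_Integration.integral_diff) (auto simp del: \<rho>.space_eq_univ)
    also have "\<dots> \<le> 1 - g (1 / K) / g 0" using L_ge[of "1 / K" n] K by simp
    finally show ?thesis .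
  qed
  have "tight \<rho>"
    unfolding tight_def
  proof (intro conjI allI impI \<rho>d)
    fix \<epsilon> :: real assume \<epsilon>: "0 < \<epsilon>"
    have "((\<lambda>K. 1 - g (1 / K) / g 0) \<longlongrightarrow> 1 - g 0 / g 0) at_top"
    proof (intro tendsto_intros continuous_on_tendsto_compose[OF cont])
      show "((\<lambda>K. 1 / K :: real) \<longlongrightarrow> 0) at_top"
        by (intro tendsto_divide_0[OF tendsto_const] filterlim_at_top_imp_at_infinity filterlim_ident)
      show "\<forall>\<^sub>F K in at_top. 1 / K \<in> {0::real..}"
        using eventually_gt_at_top[of 0] by eventually_elim auto
    qed (use g0 in auto)
    hence "\<forall>\<^sub>F K in at_top. 1 - g (1 / K) / g 0 < \<epsilon> / 2"
      using \<epsilon> g0 by (intro order_tendstoD) auto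
    then obtain K where K: "0 < K" "1 - g (1 / K) / g 0 < \<epsilon> / 2"
      using eventually_conj[OF eventually_gt_at_top[of 0]] eventually_happens'[OF trivial_limit_at_top_linorder]
      by (metis (mono_tags, lifting))
    have "1 - \<epsilon> < measure (\<rho> n) {-1<..K}" for n
    proof -
      have "{-1<..K} = UNIV - ({..-1} \<union> {K<..})" by auto
      hence "measure (\<rho> n) {-1<..K} = 1 - measure (\<rho> n) ({..-1} \<union> {K<..})"
        using \<rho>.prob_compl[of "{..-1} \<union> {K<..}"] by simp
      moreover have "measure (\<rho> n) ({..-1} \<union> {K<..}) \<le> measure (\<rho> n) {..-1} + measure (\<rho> n) {K<..}"
        by (rule measure_Un_le) auto
      ultimately show ?thesis using tail[OF K(1), of n] K(2) \<rho>neg[of n] by linarith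
    qed
    thus "\<exists>a b. a < b \<and> (\<forall>n. 1 - \<epsilon> < measure (\<rho> n) {a<..b})"
      using K by (intro exI[of _ "-1"] exI[of _ K]) auto
  qed
  from tight_imp_convergent_subsubsequence[OF this, of id]
  obtain r M where r: "strict_mono r" and M: "real_distribution M" and wc: "weak_conv_m (\<rho> \<circ> r) M"
    by (auto simp: strict_mono_id)
  interpret M: real_distribution M by (rule M)
  have lap: "g t = g 0 * (\<integral>u. exp (- t * max u 0) \<partial>M)" if t: "0 < t" for t
  proof -
    have "(\<lambda>n. \<integral>u. exp (- t * max u 0) \<partial>(\<rho> \<circ> r) n) \<longlonglongrightarrow> (\<integral>u. exp (- t * max u 0) \<partial>M)"
    proof (rule weak_conv_imp_integral_bdd_continuous_conv[where B = 1])
      show "real_distribution ((\<rho> \<circ> r) n)" for n using \<rho>d by simp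
      show "isCont (\<lambda>u. exp (- t * max u 0)) u" for u by (intro continuous_intros)
    qed (use t wc M in \<open>auto simp: o_def\<close>)
    moreover have "(\<lambda>n. \<integral>u. exp (- t * max u 0) \<partial>\<rho> n) \<longlonglongrightarrow> g t / g 0"
      unfolding L\<rho>[OF t]
    proof (intro tendsto_intros continuous_on_tendsto_compose[OF cont])
      show "(\<lambda>n. real (Suc n) * (1 - exp (- t / real (Suc n)))) \<longlonglongrightarrow> t"
        by real_asymp
      show "\<forall>\<^sub>F n in sequentially. real (Suc n) * (1 - exp (- t / real (Suc n))) \<in> {0..}"
        using t by (intro always_eventually) auto
    qed (use t g0 in auto)
    hence "(\<lambda>n. \<integral>u. exp (- t * max u 0) \<partial>(\<rho> \<circ> r) n) \<longlonglongrightarrow> g t / g 0"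
      using LIMSEQ_subseq_LIMSEQ[OF _ r] by (fastforce simp: o_def)
    ultimately have "(\<integral>u. exp (- t * max u 0) \<partial>M) = g t / g 0" by (rule LIMSEQ_unique)
    thus ?thesis using g0 by simp
  qed
  show ?thesis
  proof
    \<comment> \<open>The support of the weak limit \<open>M\<close> was not determined, so
      \<open>M\<close> is pushed to the half-line as well; the integrals computed in
      \<open>lap\<close> are unaffected.\<close>
    show "real_distribution (distr M borel (\<lambda>u. max u 0))"
      by (rule M.real_distribution_distr) measurable
    show "AE u in distr M borel (\<lambda>u. max u 0). 0 \<le> u"
      by (subst AE_distr_iff) auto
    show "g t = g 0 * (\<integral>u. exp (- t * u) \<partial>distr M borel (\<lambda>u. max u 0))" if "0 \<le> t" for t
    proof (cases "t = 0")
      case True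
      thus ?thesis using M.prob_space by (simp add: integral_distr measure_distr del: M.space_eq_univ)
    next
      case False
      thus ?thesis using lap[of t] that by (simp add: integral_distr)
    qed
  qed
qed

section \<open>Schoenberg's theorem: Gaussian scale mixtures\<close>

theorem schoenberg:
  fixes \<kappa> :: "real \<Rightarrow> real"
  assumes cm: "completely_monotone (\<lambda>t. \<kappa> (sqrt t))" and cont: "continuous_on {0..} \<kappa>"
    and pos: "0 < \<kappa> 0"
  obtains \<mu> where "represented_by \<kappa> \<mu>"
proof -
  have "continuous_on {0..} (\<lambda>t. \<kappa> (sqrt t))"
    by (rule continuous_on_compose2[OF cont]) (auto intro!: continuous_intros)
  then obtain M where M: "real_distribution M" "AE u in M. 0 \<le> u"
    and lap: "\<And>t. 0 \<le> t \<Longrightarrow> \<kappa> (sqrt t) = \<kappa> 0 * (\<integral>u. exp (- t * u) \<partial>M)"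
    using bernstein[OF cm] pos by auto
  interpret M: real_distribution M by (rule M)
  let ?N = "std_normal_distribution"
  interpret N: real_distribution ?N by (rule real_dist_normal_dist)
  interpret MN: pair_prob_space M ?N ..
  \<comment> \<open>Given \<open>u\<close>, this is a centred normal variable of variance
    \<open>2 * u\<close>, with characteristic function \<open>exp (- s\<^sup>2 * u)\<close>.
    Integrating over \<open>u\<close> yields the Laplace transform of \<open>M\<close> at
    \<open>s\<^sup>2\<close>.\<close>
  define X :: "real \<times> real \<Rightarrow> real" where "X = (\<lambda>(u, z). sqrt (2 * u) * z)"
  have [measurable]: "X \<in> borel_measurable (M \<Otimes>\<^sub>M ?N)" unfolding X_def by measurable
  have ft: "fourier_transform (distr (M \<Otimes>\<^sub>M ?N) borel X) s = complex_of_real (\<integral>u. exp (- s\<^sup>2 * u) \<partial>M)" for s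
  proof -
    have "fourier_transform (distr (M \<Otimes>\<^sub>M ?N) borel X) s = (CLINT p|(M \<Otimes>\<^sub>M ?N). exp (\<i> * complex_of_real (s * X p)))"
      unfolding fourier_transform_def by (subst integral_distr) auto
    also have "\<dots> = (CLINT u|M. CLINT z|?N. exp (\<i> * complex_of_real (s * X (u, z))))"
      by (rule MN.integral_fst'[symmetric], rule MN.P.integrable_const_bound[where B = 1]) auto
    also have "\<dots> = (CLINT u|M. complex_of_real (exp (- s\<^sup>2 * u)))"
    \<comment> \<open>The identity needs \<open>(sqrt (2 * u))\<^sup>2 = 2 * u\<close>, which holds
      only for \<open>u \<ge> 0\<close>, hence for almost every \<open>u\<close>.\<close>
    proof (rule integral_cong_AE)
      show "AE u in M. (CLINT z|?N. exp (\<i> * complex_of_real (s * X (u, z)))) = complex_of_real (exp (- s\<^sup>2 * u))"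
        using M(2)
      proof eventually_elim
        case (elim u)
        have "(CLINT z|?N. exp (\<i> * complex_of_real (s * X (u, z)))) = char ?N (s * sqrt (2 * u))"
          by (simp add: char_def X_def mult.assoc)
        also have "\<dots> = complex_of_real (exp (- s\<^sup>2 * u))"
          using elim by (simp add: char_std_normal_distribution power_mult_distrib)
        finally show ?case .
      qed
    qed measurable
    also have "\<dots> = complex_of_real (\<integral>u. exp (- s\<^sup>2 * u) \<partial>M)" by simp
    finally show ?thesis .
  qed
  show ?thesis
  proof
    show "represented_by \<kappa> (distr (M \<Otimes>\<^sub>M ?N) borel X)"
      unfolding represented_by_def borel_prob_def
    proof (intro conjI allI)
      show "prob_space (distr (M \<Otimes>\<^sub>M ?N) borel X)" by (rule MN.P.prob_space_distr) measurable
      fix s t :: real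
      show "complex_of_real (\<kappa> \<bar>s - t\<bar>) = complex_of_real (\<kappa> 0) * fourier_transform (distr (M \<Otimes>\<^sub>M ?N) borel X) (s - t)"
        using lap[of "(s - t)\<^sup>2"] by (simp add: ft)
    qed simp
  qed
qed

section \<open>Reproducing kernel Hilbert spaces\<close>

text \<open>
  A list \<open>[(c\<^sub>1, x\<^sub>1), \<dots>]\<close> stands for the formal combination \<open>\<Sum> c\<^sub>i \<delta>(x\<^sub>i)\<close>.
\<close>

definition lincomb :: "(real \<times> 'x) list \<Rightarrow> ('x \<Rightarrow> real) \<Rightarrow> real" where
  "lincomb a f = (\<Sum>(c, x)\<leftarrow>a. c * f x)"

definition scale :: "real \<Rightarrow> (real \<times> 'x) list \<Rightarrow> (real \<times> 'x) list" where
  "scale r a = map (\<lambda>(c, x). (r * c, x)) a"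

definition gram :: "('x \<Rightarrow> 'x \<Rightarrow> real) \<Rightarrow> (real \<times> 'x) list \<Rightarrow> (real \<times> 'x) list \<Rightarrow> real" where
  "gram k a b = lincomb a (\<lambda>x. lincomb b (k x))"

lemma lincomb_Nil [simp]: "lincomb [] f = 0"
  and lincomb_Cons [simp]: "lincomb ((c, x) # a) f = c * f x + lincomb a f"
  and lincomb_append [simp]: "lincomb (a @ b) f = lincomb a f + lincomb b f"
  by (auto simp: lincomb_def)

lemma lincomb_scale [simp]: "lincomb (scale r a) f = r * lincomb a f"
  by (induction a) (auto simp: scale_def algebra_simps)

lemma lincomb_add: "lincomb a (\<lambda>x. f x + g x) = lincomb a f + lincomb a g"
  and lincomb_diff: "lincomb a (\<lambda>x. f x - g x) = lincomb a f - lincomb a g"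
  and lincomb_cmult: "lincomb a (\<lambda>x. r * f x) = r * lincomb a f"
  and lincomb_zero: "lincomb a (\<lambda>x. 0) = 0"
  by (induction a) (auto simp: algebra_simps)

lemma tendsto_lincomb:
  "(\<And>x. ((\<lambda>n. f n x) \<longlongrightarrow> g x) F) \<Longrightarrow> ((\<lambda>n. lincomb a (f n)) \<longlongrightarrow> lincomb a g) F"
  by (induction a) (auto intro!: tendsto_intros)

lemma has_bochner_integral_lincomb:
  assumes "\<And>x. integrable M (\<lambda>w. f w x)"
  shows "has_bochner_integral M (\<lambda>w. lincomb a (f w)) (lincomb a (\<lambda>x. \<integral>w. f w x \<partial>M))"
  by (induction a)
    (auto intro!: has_bochner_integral_add has_bochner_integral_mult_right
        has_bochner_integral_integrable assms)

lemma gram_append: "gram k (a @ b) c = gram k a c + gram k b c" "gram k a (b @ c) = gram k a b + gram k a c"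
  by (auto simp: gram_def lincomb_add)

lemma gram_scale: "gram k (scale r a) b = r * gram k a b" "gram k a (scale r b) = r * gram k a b"
  by (auto simp: gram_def lincomb_cmult)

lemma gram_commute:
  assumes "\<And>x y. k x y = k y x"
  shows "gram k a b = gram k b a"
proof (induction a)
  case Nil
  show ?case by (simp add: gram_def lincomb_zero)
next
  case (Cons p a)
  have "k x = (\<lambda>z. k z x)" for x using assms by (intro ext)
  from arg_cong[OF this, of "lincomb b"]
  have "lincomb b (k x) = gram k b [(1, x)]" for x unfolding gram_def by simp
  moreover obtain c x where "p = (c, x)" by force
  ultimately show ?case using Cons by (simp add: gram_def lincomb_add lincomb_cmult)
qed

lemma gram_nonneg:
  assumes "is_kernel k"
  shows "0 \<le> gram k a a"
proof -
  have "gram k a a = (\<Sum>i<length a. \<Sum>j<length a. fst (a ! i) * fst (a ! j) * k (snd (a ! i)) (snd (a ! j)))"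
    by (simp add: gram_def lincomb_def sum_list_sum_nth split_beta atLeast0LessThan sum_distrib_left mult.assoc)
  thus ?thesis
    using assms[unfolded is_kernel_def, THEN conjunct2, rule_format,
      of "\<lambda>i. fst (a ! i)" "\<lambda>i. snd (a ! i)" "length a"] by simp
qed

text \<open>Removing the linear part leaves an additive function that vanishes at the integers. It
  has period 1 and is therefore bounded everywhere, while additivity would make it unbounded along
  the multiples of a point where it is nonzero.\<close>

lemma bounded_additive_imp_linear:
  fixes f :: "real \<Rightarrow> real"
  assumes add: "\<And>x y. f (x + y) = f x + f y" and bd: "\<And>x. 0 \<le> x \<Longrightarrow> x \<le> 1 \<Longrightarrow> \<bar>f x\<bar> \<le> B"
  shows "f x = x * f 1"
proof -
  define h where "h x = f x - x * f 1" for x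
  have hadd: "h (x + y) = h x + h y" for x y by (simp add: h_def add algebra_simps)
  have h1: "h 1 = 0" by (simp add: h_def)
  have h0: "h 0 = 0" using hadd[of 0 0] by simp
  have hneg: "h (- x) = - h x" for x using hadd[of x "- x"] h0 by simp
  have hmul: "h (real n * x) = real n * h x" for n x
    by (induction n) (auto simp: h0 hadd algebra_simps)
  have hnat: "h (real n) = 0" for n using hmul[of n 1] h1 by simp
  have hint: "h (of_int i) = 0" for i
    by (cases i rule: int_cases2) (auto simp: hnat hneg)
  have bd': "\<bar>h x\<bar> \<le> B + \<bar>f 1\<bar>" for x
  proof -
    have "h x = h (frac x)" using hadd[of "frac x" "of_int \<lfloor>x\<rfloor>"] hint by (simp add: frac_def)
    moreover have fr: "0 \<le> frac x" "frac x \<le> 1" using frac_lt_1[of x] by auto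
    moreover have "\<bar>frac x * f 1\<bar> \<le> \<bar>f 1\<bar>" using fr by (simp add: abs_mult mult_left_le_one_le)
    ultimately show ?thesis using bd[OF fr] unfolding h_def by linarith
  qed
  have "h x = 0"
  proof (rule ccontr)
    assume "h x \<noteq> 0"
    then obtain n where "B + \<bar>f 1\<bar> < real n * \<bar>h x\<bar>" using reals_Archimedean3[of "\<bar>h x\<bar>"] by auto
    thus False using bd'[of "real n * x"] by (simp add: hmul abs_mult)
  qed
  thus ?thesis by (simp add: h_def)
qed

text \<open>
  The squared norm of the dual of the pre-Hilbert space spanned by the functions \<open>k(\<cdot>, x)\<close>. In this
  variational form the parallelogram law is a change of variables, and the space of functions
  with finite norm is complete.
\<close>

definition rkhs_energy :: "('x \<Rightarrow> 'x \<Rightarrow> real) \<Rightarrow> ('x \<Rightarrow> real) \<Rightarrow> real" where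
  "rkhs_energy k f = (SUP a. 2 * lincomb a f - gram k a a)"

definition rkhs :: "('x \<Rightarrow> 'x \<Rightarrow> real) \<Rightarrow> ('x \<Rightarrow> real) set" where
  "rkhs k = {f. bdd_above (range (\<lambda>a. 2 * lincomb a f - gram k a a))}"

definition rkhs_inner :: "('x \<Rightarrow> 'x \<Rightarrow> real) \<Rightarrow> ('x \<Rightarrow> real) \<Rightarrow> ('x \<Rightarrow> real) \<Rightarrow> real" where
  "rkhs_inner k f g = (rkhs_energy k (\<lambda>x. f x + g x) - rkhs_energy k (\<lambda>x. f x - g x)) / 4"

section \<open>The energy norm and its inner product\<close>

lemma rkhs_energy_upper: "f \<in> rkhs k \<Longrightarrow> 2 * lincomb a f - gram k a a \<le> rkhs_energy k f"
  unfolding rkhs_def rkhs_energy_def by (auto intro: cSUP_upper)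

lemma rkhs_energy_least:
  assumes "\<And>a. 2 * lincomb a f - gram k a a \<le> C"
  shows "f \<in> rkhs k" "rkhs_energy k f \<le> C"
  using assms unfolding rkhs_def rkhs_energy_def by (auto intro!: bdd_aboveI cSUP_least)

lemma rkhs_energy_nonneg: "f \<in> rkhs k \<Longrightarrow> 0 \<le> rkhs_energy k f"
  using rkhs_energy_upper[of f k "[]"] by (simp add: gram_def)

lemma rkhs_zero: "(\<lambda>x. 0) \<in> rkhs k" "rkhs_energy k (\<lambda>x. 0) = 0" if "is_kernel k"
proof -
  have *: "2 * lincomb a (\<lambda>x. 0) - gram k a a \<le> 0" for a
    using gram_nonneg[OF that, of a] by (simp add: lincomb_zero)
  show "(\<lambda>x. 0) \<in> rkhs k" by (rule rkhs_energy_least(1)[OF *])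
  thus "rkhs_energy k (\<lambda>x. 0) = 0"
    using rkhs_energy_least(2)[OF *] rkhs_energy_nonneg[of "\<lambda>x. 0" k] by simp
qed

text \<open>Rescaling the test combination by \<open>1 / c\<close> carries one supremum into the
  other. Applying the bound again with \<open>1 / c\<close> gives equality in
  \<open>rkhs_cmult\<close>.\<close>

lemma rkhs_energy_cmult_le:
  assumes f: "f \<in> rkhs k" and c: "c \<noteq> 0"
  shows "(\<lambda>x. c * f x) \<in> rkhs k" "rkhs_energy k (\<lambda>x. c * f x) \<le> c\<^sup>2 * rkhs_energy k f"
proof -
  have *: "2 * lincomb a (\<lambda>x. c * f x) - gram k a a \<le> c\<^sup>2 * rkhs_energy k f" for a
  proof -
    have "c\<^sup>2 * (2 * lincomb (scale (1 / c) a) f - gram k (scale (1 / c) a) (scale (1 / c) a))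
        \<le> c\<^sup>2 * rkhs_energy k f"
      by (intro mult_left_mono rkhs_energy_upper f) auto
    thus ?thesis using c by (simp add: lincomb_cmult gram_scale right_diff_distrib power2_eq_square)
  qed
  show "(\<lambda>x. c * f x) \<in> rkhs k" "rkhs_energy k (\<lambda>x. c * f x) \<le> c\<^sup>2 * rkhs_energy k f"
    using rkhs_energy_least[OF *] by auto
qed

lemma rkhs_cmult:
  assumes k: "is_kernel k" and f: "f \<in> rkhs k"
  shows "(\<lambda>x. c * f x) \<in> rkhs k" "rkhs_energy k (\<lambda>x. c * f x) = c\<^sup>2 * rkhs_energy k f"
proof -
  show 1: "(\<lambda>x. c * f x) \<in> rkhs k"
    using rkhs_energy_cmult_le(1)[OF f, of c] rkhs_zero(1)[OF k] by (cases "c = 0") auto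
  show "rkhs_energy k (\<lambda>x. c * f x) = c\<^sup>2 * rkhs_energy k f"
  proof (cases "c = 0")
    case True
    thus ?thesis using rkhs_zero(2)[OF k] by simp
  next
    case False
    have "rkhs_energy k f \<le> (1 / c)\<^sup>2 * rkhs_energy k (\<lambda>x. c * f x)"
      using rkhs_energy_cmult_le(2)[OF 1, of "1 / c"] False by simp
    hence "c\<^sup>2 * rkhs_energy k f \<le> rkhs_energy k (\<lambda>x. c * f x)"
      using False by (simp add: power_divide pos_le_divide_eq mult.commute)
    thus ?thesis using rkhs_energy_cmult_le(2)[OF f False] by simp
  qed
qed

text \<open>Testing the sum with \<open>a\<close> and the difference with \<open>b\<close> amounts
  to testing \<open>f\<close> with half of \<open>a + b\<close> and \<open>g\<close> with half of
  \<open>a - b\<close>, both counted twice. The empty combination for \<open>a\<close> or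
  \<open>b\<close> gives membership; then the two suprema are taken one after the other.\<close>

lemma rkhs_parallelogram_le:
  assumes k: "is_kernel k" and f: "f \<in> rkhs k" and g: "g \<in> rkhs k"
  shows "(\<lambda>x. f x + g x) \<in> rkhs k" "(\<lambda>x. f x - g x) \<in> rkhs k"
    "rkhs_energy k (\<lambda>x. f x + g x) + rkhs_energy k (\<lambda>x. f x - g x)
      \<le> 2 * rkhs_energy k f + 2 * rkhs_energy k g"
proof -
  define C where "C = 2 * rkhs_energy k f + 2 * rkhs_energy k g"
  have comm: "gram k a b = gram k b a" for a b
    using k gram_commute[of k a b] by (auto simp: is_kernel_def)
  have *: "(2 * lincomb a (\<lambda>x. f x + g x) - gram k a a) + (2 * lincomb b (\<lambda>x. f x - g x) - gram k b b) \<le> C" for a b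
  proof -
    define p where "p = scale (1 / 2) (a @ b)"
    define q where "q = scale (1 / 2) (a @ scale (-1) b)"
    have "2 * (2 * lincomb p f - gram k p p) + 2 * (2 * lincomb q g - gram k q q) \<le> C"
      using rkhs_energy_upper[OF f, of p] rkhs_energy_upper[OF g, of q] by (simp add: C_def)
    thus ?thesis
      by (simp add: p_def q_def lincomb_add lincomb_diff gram_append gram_scale comm[of b a] algebra_simps)
  qed
  have "2 * lincomb a (\<lambda>x. f x + g x) - gram k a a \<le> C" for a
    using *[of a "[]"] by (simp add: gram_def)
  thus plus: "(\<lambda>x. f x + g x) \<in> rkhs k" by (rule rkhs_energy_least)
  have "2 * lincomb b (\<lambda>x. f x - g x) - gram k b b \<le> C" for b
    using *[of "[]" b] by (simp add: gram_def)
  thus minus: "(\<lambda>x. f x - g x) \<in> rkhs k" by (rule rkhs_energy_least)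
  have "rkhs_energy k (\<lambda>x. f x + g x) \<le> C - (2 * lincomb b (\<lambda>x. f x - g x) - gram k b b)" for b
    using * by (intro rkhs_energy_least) (simp add: algebra_simps)
  hence "rkhs_energy k (\<lambda>x. f x - g x) \<le> C - rkhs_energy k (\<lambda>x. f x + g x)"
    by (intro rkhs_energy_least) (simp add: algebra_simps)
  thus "rkhs_energy k (\<lambda>x. f x + g x) + rkhs_energy k (\<lambda>x. f x - g x)
      \<le> 2 * rkhs_energy k f + 2 * rkhs_energy k g"
    by (simp add: C_def)
qed

text \<open>The reverse inequality is the same one applied to the sum and the difference of
  \<open>f\<close> and \<open>g\<close>, which have \<open>2 f\<close> and \<open>2 g\<close> as
  their own sum and difference.\<close>

lemma rkhs_parallelogram:
  assumes k: "is_kernel k" and f: "f \<in> rkhs k" and g: "g \<in> rkhs k"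
  shows "rkhs_energy k (\<lambda>x. f x + g x) + rkhs_energy k (\<lambda>x. f x - g x)
      = 2 * rkhs_energy k f + 2 * rkhs_energy k g"
proof (rule antisym[OF rkhs_parallelogram_le(3)[OF assms]])
  have "rkhs_energy k (\<lambda>x. 2 * f x) + rkhs_energy k (\<lambda>x. 2 * g x)
      \<le> 2 * rkhs_energy k (\<lambda>x. f x + g x) + 2 * rkhs_energy k (\<lambda>x. f x - g x)"
    using rkhs_parallelogram_le(3)[OF k rkhs_parallelogram_le(1,2)[OF assms]] by simp
  thus "2 * rkhs_energy k f + 2 * rkhs_energy k g
      \<le> rkhs_energy k (\<lambda>x. f x + g x) + rkhs_energy k (\<lambda>x. f x - g x)"
    using rkhs_cmult(2)[OF k f, of 2] rkhs_cmult(2)[OF k g, of 2] by simp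
qed

lemmas rkhs_add = rkhs_parallelogram_le(1)
lemmas rkhs_diff = rkhs_parallelogram_le(2)

lemma rkhs_sum:
  assumes "is_kernel k" "\<And>i. i \<in> I \<Longrightarrow> f i \<in> rkhs k"
  shows "(\<lambda>x. \<Sum>i\<in>I. f i x) \<in> rkhs k"
  using assms by (induction I rule: infinite_finite_induct) (auto intro: rkhs_zero rkhs_add)

lemma rkhs_energy_minus_commute:
  assumes k: "is_kernel k" and f: "f \<in> rkhs k" and g: "g \<in> rkhs k"
  shows "rkhs_energy k (\<lambda>x. f x - g x) = rkhs_energy k (\<lambda>x. g x - f x)"
  using rkhs_cmult(2)[OF k rkhs_diff[OF k f g], of "-1"] by (simp add: minus_diff_eq)

lemma rkhs_inner_commute:
  assumes "is_kernel k" "f \<in> rkhs k" "g \<in> rkhs k"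
  shows "rkhs_inner k f g = rkhs_inner k g f"
  using rkhs_energy_minus_commute[OF assms] by (simp add: rkhs_inner_def add.commute)

lemma rkhs_inner_self:
  assumes "is_kernel k" "f \<in> rkhs k"
  shows "rkhs_inner k f f = rkhs_energy k f"
  using rkhs_cmult(2)[OF assms, of 2] rkhs_zero(2)[OF assms(1)] by (simp add: rkhs_inner_def)

text \<open>The parallelogram law makes the polarised form additive (Jordan--von Neumann).\<close>

lemma rkhs_inner_add:
  assumes k: "is_kernel k" and f: "f \<in> rkhs k" and g: "g \<in> rkhs k" and h: "h \<in> rkhs k"
  shows "rkhs_inner k (\<lambda>x. f x + g x) h = rkhs_inner k f h + rkhs_inner k g h"
proof -
  note mem = rkhs_add[OF k] rkhs_diff[OF k] f g h
  let ?N = "rkhs_energy k"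
  have 1: "?N (\<lambda>x. f x + g x + h x) + ?N (\<lambda>x. f x + h x - g x) = 2 * ?N (\<lambda>x. f x + h x) + 2 * ?N g"
    using rkhs_parallelogram[OF k, of "\<lambda>x. f x + h x" g] by (simp add: mem algebra_simps)
  have 2: "?N (\<lambda>x. f x + g x - h x) + ?N (\<lambda>x. f x - h x - g x) = 2 * ?N (\<lambda>x. f x - h x) + 2 * ?N g"
    using rkhs_parallelogram[OF k, of "\<lambda>x. f x - h x" g] by (simp add: mem algebra_simps)
  have 3: "?N (\<lambda>x. f x + h x - g x) + ?N (\<lambda>x. f x + g x - h x) = 2 * ?N f + 2 * ?N (\<lambda>x. g x - h x)"
    using rkhs_parallelogram[OF k, of f "\<lambda>x. h x - g x"] rkhs_energy_minus_commute[OF k h g]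
    by (simp add: mem algebra_simps)
  have 4: "?N (\<lambda>x. f x - h x - g x) + ?N (\<lambda>x. f x + g x + h x) = 2 * ?N f + 2 * ?N (\<lambda>x. g x + h x)"
    using rkhs_parallelogram[OF k, of f "\<lambda>x. g x + h x"] by (simp add: mem algebra_simps)
  \<comment> \<open>Adding the first identity minus the second to the fourth minus the third
    eliminates \<open>B\<close>, \<open>D\<close>, \<open>r\<close> and \<open>t\<close>.\<close>
  have "(A - C) / 4 = (p - q) / 4 + (u - v) / 4"
    if "A + B = 2 * p + 2 * r" "C + D = 2 * q + 2 * r" "B + C = 2 * t + 2 * v" "D + A = 2 * t + 2 * u"
    for A B C D p q r t u v :: real
    using that by (auto simp: field_simps)
  from this[OF 1 2 3 4] show ?thesis unfolding rkhs_inner_def .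
qed

text \<open>Additivity in \<open>c\<close> comes from \<open>rkhs_inner_add\<close>, and the
  parallelogram law bounds the form for \<open>c\<close> between 0 and 1;
  \<open>bounded_additive_imp_linear\<close> then gives homogeneity.\<close>

lemma rkhs_inner_cmult:
  assumes k: "is_kernel k" and f: "f \<in> rkhs k" and g: "g \<in> rkhs k"
  shows "rkhs_inner k (\<lambda>x. c * f x) g = c * rkhs_inner k f g"
proof -
  note cf = rkhs_cmult[OF k f]
  have "rkhs_inner k (\<lambda>x. c * f x) g = c * rkhs_inner k (\<lambda>x. 1 * f x) g"
  proof (rule bounded_additive_imp_linear)
    show "rkhs_inner k (\<lambda>x. (b + c) * f x) g = rkhs_inner k (\<lambda>x. b * f x) g + rkhs_inner k (\<lambda>x. c * f x) g" for b c
      using rkhs_inner_add[OF k cf(1)[of b] cf(1)[of c] g] by (simp add: distrib_right)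
    fix c :: real assume c: "0 \<le> c" "c \<le> 1"
    have "c\<^sup>2 * rkhs_energy k f \<le> 1 * rkhs_energy k f"
      using c rkhs_energy_nonneg[OF f] by (intro mult_right_mono) (auto simp: power_le_one)
    moreover have "0 \<le> rkhs_energy k (\<lambda>x. c * f x + g x)" "0 \<le> rkhs_energy k (\<lambda>x. c * f x - g x)"
      by (intro rkhs_energy_nonneg rkhs_add rkhs_diff k cf g)+
    ultimately show "\<bar>rkhs_inner k (\<lambda>x. c * f x) g\<bar> \<le> 2 * rkhs_energy k f + 2 * rkhs_energy k g"
      using rkhs_parallelogram[OF k cf(1)[of c] g] rkhs_energy_nonneg[OF f] rkhs_energy_nonneg[OF g]
      unfolding rkhs_inner_def cf(2) by (simp add: abs_le_iff field_simps)
  qed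
  thus ?thesis by simp
qed

text \<open>Shifting the test combination by \<open>- t\<close> times the point mass at
  \<open>y\<close> completes the square. The opposite shift later turns the bound into an equality,
  from which the reproducing property is read off.\<close>

lemma rkhs_add_section:
  assumes k: "is_kernel k" and f: "f \<in> rkhs k"
  shows "(\<lambda>x. f x + t * k x y) \<in> rkhs k"
    "rkhs_energy k (\<lambda>x. f x + t * k x y) \<le> rkhs_energy k f + 2 * t * f y + t\<^sup>2 * k y y"
proof -
  have comm: "gram k a b = gram k b a" for a b
    using k gram_commute[of k a b] by (auto simp: is_kernel_def)
  have sec: "lincomb a (\<lambda>x. k x y) = gram k a [(1, y)]" for a by (simp add: gram_def)
  have *: "2 * lincomb a (\<lambda>x. f x + t * k x y) - gram k a a \<le> rkhs_energy k f + 2 * t * f y + t\<^sup>2 * k y y" for a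
    using rkhs_energy_upper[OF f, of "a @ scale (- t) [(1, y)]"]
    by (simp add: lincomb_add lincomb_cmult sec gram_append gram_scale comm[of "[(1, y)]" a])
      (simp add: gram_def power2_eq_square algebra_simps)
  show "(\<lambda>x. f x + t * k x y) \<in> rkhs k"
    "rkhs_energy k (\<lambda>x. f x + t * k x y) \<le> rkhs_energy k f + 2 * t * f y + t\<^sup>2 * k y y"
    using rkhs_energy_least[OF *] by auto
qed

lemma rkhs_energy_add_section:
  assumes k: "is_kernel k" and f: "f \<in> rkhs k"
  shows "rkhs_energy k (\<lambda>x. f x + t * k x y) = rkhs_energy k f + 2 * t * f y + t\<^sup>2 * k y y"
  using rkhs_add_section(2)[OF k f, of t y]
    rkhs_add_section(2)[OF k rkhs_add_section(1)[OF k f, of t y], of "- t" y]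
  by (simp add: algebra_simps power2_eq_square)

lemma rkhs_section: "(\<lambda>x. k x y) \<in> rkhs k" if "is_kernel k"
  using rkhs_add_section(1)[OF that rkhs_zero(1)[OF that], of 1 y] by simp

lemma rkhs_reproducing:
  assumes k: "is_kernel k" and f: "f \<in> rkhs k"
  shows "rkhs_inner k f (\<lambda>x. k x y) = f y"
  using rkhs_energy_add_section[OF k f, of 1 y] rkhs_energy_add_section[OF k f, of "-1" y]
  by (simp add: rkhs_inner_def)

lemma rkhs_energy_section_diff:
  assumes k: "is_kernel k"
  shows "rkhs_energy k (\<lambda>x. k x y - k x z) = k y y - 2 * k y z + k z z"
  using rkhs_energy_add_section[OF k rkhs_section[OF k, of y], of "-1" z]
    rkhs_energy_add_section[OF k rkhs_zero(1)[OF k], of 1 y] rkhs_zero(2)[OF k]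
    k[unfolded is_kernel_def, THEN conjunct1, rule_format, of y z]
  by simp

lemma rkhs_energy_eq_0:
  assumes k: "is_kernel k" and f: "f \<in> rkhs k" and 0: "rkhs_energy k f = 0"
  shows "f = (\<lambda>x. 0)"
proof (rule ext, rule ccontr)
  fix y assume fy: "f y \<noteq> 0"
  have "0 \<le> 2 * t * f y + t\<^sup>2 * k y y" for t
    using rkhs_energy_add_section[OF k f, of t y] rkhs_energy_nonneg[OF rkhs_add_section(1)[OF k f, of t y]] 0 by simp
  \<comment> \<open>For this \<open>t\<close> the linear term outweighs the quadratic one; the
    summand 1 keeps the denominator positive even if \<open>k y y = 0\<close>.\<close>
  from this[of "- f y / (1 + k y y)"] have "0 \<le> - 2 * (f y)\<^sup>2 / (1 + k y y) + (f y)\<^sup>2 * k y y / (1 + k y y)\<^sup>2"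
    by (simp add: power2_eq_square)
  moreover have kyy: "0 \<le> k y y" using gram_nonneg[OF k, of "[(1, y)]"] by (simp add: gram_def)
  ultimately have "0 \<le> (- 2 * (f y)\<^sup>2 / (1 + k y y) + (f y)\<^sup>2 * k y y / (1 + k y y)\<^sup>2) * (1 + k y y)\<^sup>2"
    by (intro mult_nonneg_nonneg) auto
  also have "\<dots> = - (2 + k y y) * (f y)\<^sup>2" using kyy by (simp add: field_simps power2_eq_square add_nonneg_eq_0_iff)
  finally show False using kyy fy by (simp add: mult_le_0_iff zero_le_mult_iff)
qed

text \<open>Cauchy-Schwarz for the pairing of functions with formal combinations, from optimising
  the defining supremum over the multiples of \<open>a\<close>.\<close>

lemma lincomb_le_energy:
  assumes k: "is_kernel k" and f: "f \<in> rkhs k"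
  shows "lincomb a f \<le> sqrt (rkhs_energy k f) * sqrt (gram k a a)"
proof -
  define N G L where "N = rkhs_energy k f" "G = gram k a a" "L = lincomb a f"
  have *: "2 * t * L - t\<^sup>2 * G \<le> N" for t
    using rkhs_energy_upper[OF f, of "scale t a"] by (simp add: gram_scale N_G_L_def power2_eq_square mult_ac)
  have N: "0 \<le> N" and G: "0 \<le> G" using rkhs_energy_nonneg[OF f] gram_nonneg[OF k] by (auto simp: N_G_L_def)
  have "L\<^sup>2 \<le> N * G"
  proof (cases "G = 0")
    case True
    have "L = 0"
    proof (rule ccontr)
      assume "L \<noteq> 0"
      thus False using *[of "(N + 1) / (2 * L)"] True by simp
    qed
    thus ?thesis using True by simp
  next
    case False
    have "L\<^sup>2 / G \<le> N" using *[of "L / G"] False by (simp add: power2_eq_square field_simps)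
    thus ?thesis using False G by (simp add: field_simps)
  qed
  hence "L \<le> sqrt (N * G)" by (rule real_le_rsqrt)
  thus ?thesis by (simp add: N_G_L_def real_sqrt_mult)
qed

text \<open>With \<open>r = sqrt (gram k a a)\<close> this is
  \<open>2 * c * r - r\<^sup>2 \<le> c\<^sup>2\<close>. As the converse of
  \<open>lincomb_le_energy\<close> it allows norm bounds for limits and integrals to be checked on
  one formal combination at a time.\<close>

lemma rkhs_energy_leI:
  assumes k: "is_kernel k" and c: "\<And>a. lincomb a f \<le> c * sqrt (gram k a a)"
  shows "f \<in> rkhs k" "rkhs_energy k f \<le> c\<^sup>2"
proof -
  have *: "2 * lincomb a f - gram k a a \<le> c\<^sup>2" for a
  proof -
    have "0 \<le> (c - sqrt (gram k a a))\<^sup>2" by simp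
    thus ?thesis using c[of a] gram_nonneg[OF k, of a] by (simp add: power2_diff)
  qed
  show "f \<in> rkhs k" "rkhs_energy k f \<le> c\<^sup>2" using rkhs_energy_least[OF *] by auto
qed

section \<open>Completeness and Bochner integrals\<close>

lemma fdist_rkhs:
  assumes "is_kernel k" "f \<in> rkhs k" "g \<in> rkhs k"
  shows "fdist (rkhs_inner k) f g = sqrt (rkhs_energy k (\<lambda>x. f x - g x))"
  by (simp add: fdist_def fnorm_def rkhs_inner_self rkhs_diff assms)

text \<open>Evaluations are controlled by the norm, so a Cauchy sequence converges pointwise. Its
  bounds against each fixed \<open>a\<close> pass to the limit, and \<open>rkhs_energy_leI\<close>
  turns them into norm convergence.\<close>

lemma rkhs_complete:
  assumes k: "is_kernel k" and s: "\<And>n. s n \<in> rkhs k"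
    and Cauchy: "\<And>e. 0 < e \<Longrightarrow> \<exists>N. \<forall>m\<ge>N. \<forall>n\<ge>N. fdist (rkhs_inner k) (s m) (s n) < e"
  obtains f where "f \<in> rkhs k" "(\<lambda>n. fdist (rkhs_inner k) (s n) f) \<longlonglongrightarrow> 0"
proof -
  have lin: "\<bar>lincomb a (\<lambda>x. s m x - s n x)\<bar> \<le> fdist (rkhs_inner k) (s m) (s n) * sqrt (gram k a a)" for a m n
    using lincomb_le_energy[OF k rkhs_diff[OF k s s], of a m n]
      lincomb_le_energy[OF k rkhs_diff[OF k s s], of "scale (-1) a" m n]
    by (simp add: fdist_rkhs[OF k s s] gram_scale)
  have "Cauchy (\<lambda>n. s n x)" for x
  proof (rule metric_CauchyI)
    fix e :: real assume e: "0 < e"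
    define G where "G = sqrt (k x x)"
    have G: "0 \<le> G" using gram_nonneg[OF k, of "[(1, x)]"] by (simp add: G_def gram_def)
    obtain N where N: "\<And>m n. m \<ge> N \<Longrightarrow> n \<ge> N \<Longrightarrow> fdist (rkhs_inner k) (s m) (s n) < e / (1 + G)"
      using Cauchy[of "e / (1 + G)"] e G by (metis add_pos_nonneg divide_pos_pos zero_less_one)
    show "\<exists>N. \<forall>m\<ge>N. \<forall>n\<ge>N. dist (s m x) (s n x) < e"
    proof (intro exI allI impI)
      fix m n assume "m \<ge> N" "n \<ge> N"
      have "dist (s m x) (s n x) \<le> fdist (rkhs_inner k) (s m) (s n) * G"
        using lin[of "[(1, x)]" m n] by (simp add: dist_real_def gram_def G_def)
      also have "\<dots> \<le> e / (1 + G) * G" using N[OF \<open>m \<ge> N\<close> \<open>n \<ge> N\<close>] G by (intro mult_right_mono) auto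
      also have "\<dots> < e" using e G by (simp add: field_simps)
      finally show "dist (s m x) (s n x) < e" .
    qed
  qed
  then obtain f where f: "\<And>x. (\<lambda>n. s n x) \<longlonglongrightarrow> f x"
    unfolding Cauchy_convergent_iff convergent_def by metis
  have close: "\<exists>N. \<forall>m\<ge>N. (\<lambda>x. s m x - f x) \<in> rkhs k \<and> sqrt (rkhs_energy k (\<lambda>x. s m x - f x)) \<le> e"
    if e: "0 < e" for e
  proof -
    obtain N where N: "\<And>m n. m \<ge> N \<Longrightarrow> n \<ge> N \<Longrightarrow> fdist (rkhs_inner k) (s m) (s n) < e"
      using Cauchy[OF e] by blast
    have "lincomb a (\<lambda>x. s m x - f x) \<le> e * sqrt (gram k a a)" if m: "m \<ge> N" for m a
    proof (rule tendsto_upperbound)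
      show "(\<lambda>n. lincomb a (\<lambda>x. s m x - s n x)) \<longlonglongrightarrow> lincomb a (\<lambda>x. s m x - f x)"
        by (intro tendsto_lincomb tendsto_intros f)
      show "\<forall>\<^sub>F n in sequentially. lincomb a (\<lambda>x. s m x - s n x) \<le> e * sqrt (gram k a a)"
        using eventually_ge_at_top[of N]
      proof eventually_elim
        case (elim n)
        have "lincomb a (\<lambda>x. s m x - s n x) \<le> fdist (rkhs_inner k) (s m) (s n) * sqrt (gram k a a)"
          using lin[of a m n] by simp
        also have "\<dots> \<le> e * sqrt (gram k a a)"
          using N[OF m elim] gram_nonneg[OF k, of a] by (intro mult_right_mono) auto
        finally show ?case .
      qed
    qed simp
    hence "(\<lambda>x. s m x - f x) \<in> rkhs k \<and> rkhs_energy k (\<lambda>x. s m x - f x) \<le> e\<^sup>2" if "m \<ge> N" for m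
      using rkhs_energy_leI[OF k, of "\<lambda>x. s m x - f x" e] that by blast
    thus ?thesis using e by (auto intro!: exI[of _ N] real_le_lsqrt)
  qed
  show ?thesis
  proof
    obtain m where "(\<lambda>x. s m x - f x) \<in> rkhs k" using close[of 1] by auto
    from rkhs_diff[OF k s[of m] this] show fH: "f \<in> rkhs k" by simp
    show "(\<lambda>n. fdist (rkhs_inner k) (s n) f) \<longlonglongrightarrow> 0"
    proof (rule LIMSEQ_I)
      fix e :: real assume "0 < e"
      then obtain N where "\<forall>m\<ge>N. sqrt (rkhs_energy k (\<lambda>x. s m x - f x)) \<le> e / 2" using close[of "e / 2"] by auto
      thus "\<exists>N. \<forall>n\<ge>N. norm (fdist (rkhs_inner k) (s n) f - 0) < e"
        using \<open>0 < e\<close> rkhs_energy_nonneg[OF rkhs_diff[OF k s fH]]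
        by (intro exI[of _ N]) (force simp: fdist_rkhs[OF k s fH])
    qed
  qed
qed

theorem moore_aronszajn:
  assumes k: "is_kernel k"
  shows "is_rkhs k (rkhs k) (rkhs_inner k)"
  unfolding is_rkhs_def function_hilbert_space_def
proof (intro conjI ballI allI impI)
  fix s :: "nat \<Rightarrow> _ \<Rightarrow> real"
  assume "range s \<subseteq> rkhs k" "\<forall>e>0. \<exists>N. \<forall>m\<ge>N. \<forall>n\<ge>N. fdist (rkhs_inner k) (s m) (s n) < e"
  then obtain f where "f \<in> rkhs k" "(\<lambda>n. fdist (rkhs_inner k) (s n) f) \<longlonglongrightarrow> 0"
    using rkhs_complete[OF k, of s] by blast
  thus "\<exists>f\<in>rkhs k. (\<lambda>n. fdist (rkhs_inner k) (s n) f) \<longlonglongrightarrow> 0" by blast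
qed (auto simp: k rkhs_zero rkhs_add rkhs_cmult rkhs_inner_add rkhs_inner_cmult rkhs_inner_self
      rkhs_energy_nonneg rkhs_section rkhs_reproducing
      intro: rkhs_inner_commute[OF k] dest: rkhs_energy_eq_0[OF k])

text \<open>
  Testing \<open>s n - \<Phi>\<close> against a formal combination \<open>a\<close> under the integral bounds its norm by the
  \<open>L\<^sup>1\<close>-distance.
\<close>

lemma has_bochner_integral_in_rkhs:
  assumes k: "is_kernel k" and P: "prob_space P" and \<tau>: "\<And>n. simple_function P (\<tau> n)"
    and int: "\<And>x. integrable P (\<lambda>y. k x y)"
    and meas: "\<And>n. (\<lambda>y. k y y - 2 * k y (\<tau> n y) + k (\<tau> n y) (\<tau> n y)) \<in> borel_measurable P"
    and lim: "(\<lambda>n. \<integral>\<^sup>+y. ennreal (sqrt (k y y - 2 * k y (\<tau> n y) + k (\<tau> n y) (\<tau> n y))) \<partial>P) \<longlonglongrightarrow> 0"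
  shows "has_bochner_integral_in (rkhs k) (rkhs_inner k) P (\<lambda>y x. k x y) (\<lambda>x. \<integral>y. k x y \<partial>P)"
proof -
  interpret prob_space P by (rule P)
  define d where "d n y = sqrt (k y y - 2 * k y (\<tau> n y) + k (\<tau> n y) (\<tau> n y))" for n y
  define s where "s n y = (\<lambda>x. k x (\<tau> n y))" for n y
  define \<Phi> where "\<Phi> = (\<lambda>x. \<integral>y. k x y \<partial>P)"
  have sec: "(\<lambda>x. k x y) \<in> rkhs k" for y by (rule rkhs_section[OF k])
  have d: "fdist (rkhs_inner k) (\<lambda>x. k x y) (s n y) = d n y" for n y
    by (simp add: fdist_rkhs[OF k sec] s_def sec d_def rkhs_energy_section_diff[OF k])
  have d_sym: "fdist (rkhs_inner k) (s n y) (\<lambda>x. k x y) = d n y" for n y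
    unfolding d[symmetric] s_def
    by (simp add: fdist_rkhs[OF k sec] sec rkhs_energy_minus_commute[OF k sec sec])
  have d_nonneg: "0 \<le> d n y" for n y
    unfolding d[symmetric] by (simp add: s_def fdist_rkhs[OF k sec] sec rkhs_energy_nonneg[OF rkhs_diff[OF k sec sec]])
  have d_meas [measurable]: "d n \<in> borel_measurable P" for n
    using meas[of n] unfolding d_def by measurable
  have simple: "simple_function P (s n)" for n
    unfolding s_def using simple_function_compose[OF \<tau>[of n], of "\<lambda>z x. k x z"] by (simp add: o_def)
  \<comment> \<open>Evaluated at a point \<open>x\<close>, the function-valued simple integral is an
    ordinary real integral, which can be compared with \<open>\<Phi> x\<close>.\<close>
  have s_int: "has_bochner_integral P (\<lambda>y. s n y x) (simple_integral_in P (s n) x)" for n x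
  proof -
    have "simple_function P (\<lambda>y. s n y x)"
      using simple_function_compose[OF simple[of n], of "\<lambda>f. f x"] by (simp add: o_def)
    have "has_bochner_integral P (\<lambda>y. \<Sum>h\<in>s n ` space P. indicator {w \<in> space P. s n w = h} y * h x)
        (\<Sum>h\<in>s n ` space P. measure P {w \<in> space P. s n w = h} * h x)"
    proof (intro has_bochner_integral_sum has_bochner_integral_mult_left)
      fix h assume "h \<in> s n ` space P"
      hence "s n -` {h} \<inter> space P \<in> sets P" using simple unfolding simple_function_def by blast
      moreover have "s n -` {h} \<inter> space P = {w \<in> space P. s n w = h}" by auto
      ultimately show "has_bochner_integral P (indicator {w \<in> space P. s n w = h}) (measure P {w \<in> space P. s n w = h})"
        by (intro has_bochner_integral_real_indicator) (auto simp: emeasure_finite less_top[symmetric])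
    qed
    also have "?this \<longleftrightarrow> ?thesis"
      unfolding simple_integral_in_def
    proof (rule has_bochner_integral_cong)
      fix y assume y: "y \<in> space P"
      have "(\<Sum>h\<in>s n ` space P. indicator {w \<in> space P. s n w = h} y * h x) =
          (\<Sum>h\<in>s n ` space P. if s n y = h then h x else 0)"
        using y by (intro sum.cong) (auto simp: indicator_def)
      also have "\<dots> = s n y x"
        using y simple[of n] by (subst sum.delta') (auto simp: simple_function_def)
      finally show "(\<Sum>h\<in>s n ` space P. indicator {w \<in> space P. s n w = h} y * h x) = s n y x" .
    qed auto
    finally show ?thesis .
  qed
  \<comment> \<open>The limit hypothesis controls only large \<open>n\<close>, so \<open>d n\<close>
    is known to be integrable only eventually.\<close>
  have ev: "\<forall>\<^sub>F n in sequentially. (\<integral>\<^sup>+y. ennreal (d n y) \<partial>P) < 1"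
    using lim unfolding d_def by (rule order_tendstoD) simp
  have d_int: "integrable P (d n)" if "(\<integral>\<^sup>+y. ennreal (d n y) \<partial>P) < 1" for n
    using that d_nonneg by (intro integrableI_nonneg) (auto simp: less_trans)
  have bound: "(\<lambda>x. simple_integral_in P (s n) x - \<Phi> x) \<in> rkhs k \<and>
      sqrt (rkhs_energy k (\<lambda>x. simple_integral_in P (s n) x - \<Phi> x)) \<le> (\<integral>y. d n y \<partial>P)"
    if dn: "integrable P (d n)" for n
  proof -
    have "lincomb a (\<lambda>x. simple_integral_in P (s n) x - \<Phi> x) \<le> (\<integral>y. d n y \<partial>P) * sqrt (gram k a a)" for a
    proof -
      have eq: "(\<lambda>x. simple_integral_in P (s n) x - \<Phi> x) = (\<lambda>x. \<integral>y. s n y x - k x y \<partial>P)"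
        using s_int int by (auto simp: \<Phi>_def has_bochner_integral_iff)
      have hb: "has_bochner_integral P (\<lambda>y. lincomb a (\<lambda>x. s n y x - k x y))
          (lincomb a (\<lambda>x. \<integral>y. s n y x - k x y \<partial>P))"
        using s_int int
        by (intro has_bochner_integral_lincomb Bochner_Integration.integrable_diff) (auto simp: has_bochner_integral_iff)
      have "(\<integral>y. lincomb a (\<lambda>x. s n y x - k x y) \<partial>P) \<le> (\<integral>y. d n y * sqrt (gram k a a) \<partial>P)"
      proof (rule integral_mono)
        fix y
        show "lincomb a (\<lambda>x. s n y x - k x y) \<le> d n y * sqrt (gram k a a)"
          using lincomb_le_energy[OF k rkhs_diff[OF k sec sec], of a "\<tau> n y" y]
          unfolding d_sym[symmetric] by (simp add: s_def fdist_rkhs[OF k sec] sec)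
      qed (use hb dn in \<open>auto simp: has_bochner_integral_iff\<close>)
      thus ?thesis using hb unfolding eq by (simp add: has_bochner_integral_iff)
    qed
    from rkhs_energy_leI[OF k this]
    show ?thesis using d_nonneg by (auto intro!: real_le_lsqrt integral_nonneg_AE)
  qed
  have si: "simple_integral_in P (s n) \<in> rkhs k" for n
    unfolding simple_integral_in_def
    by (intro rkhs_sum rkhs_cmult k) (auto simp: s_def sec)
  have \<Phi>: "\<Phi> \<in> rkhs k"
  proof -
    obtain n where "(\<integral>\<^sup>+y. ennreal (d n y) \<partial>P) < 1" using eventually_happens'[OF sequentially_bot ev] by auto
    from bound[OF d_int[OF this]] have "(\<lambda>x. simple_integral_in P (s n) x - \<Phi> x) \<in> rkhs k" by blast
    from rkhs_diff[OF k si[of n] this] show ?thesis by simp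
  qed
  have "(\<lambda>n. fdist (rkhs_inner k) (simple_integral_in P (s n)) \<Phi>) \<longlonglongrightarrow> 0"
  proof (rule tendsto_sandwich[OF _ _ tendsto_const])
    show "\<forall>\<^sub>F n in sequentially. 0 \<le> fdist (rkhs_inner k) (simple_integral_in P (s n)) \<Phi>"
      by (simp add: fdist_rkhs[OF k si \<Phi>] rkhs_energy_nonneg[OF rkhs_diff[OF k si \<Phi>]])
    show "\<forall>\<^sub>F n in sequentially. fdist (rkhs_inner k) (simple_integral_in P (s n)) \<Phi>
        \<le> enn2real (\<integral>\<^sup>+y. ennreal (d n y) \<partial>P)"
      using ev
    proof eventually_elim
      case (elim n)
      have "enn2real (\<integral>\<^sup>+y. ennreal (d n y) \<partial>P) = (\<integral>y. d n y \<partial>P)"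
        using d_nonneg by (intro integral_eq_nn_integral[symmetric]) auto
      thus ?case using bound[OF d_int[OF elim]] by (simp add: fdist_rkhs[OF k si \<Phi>])
    qed
    show "(\<lambda>n. enn2real (\<integral>\<^sup>+y. ennreal (d n y) \<partial>P)) \<longlonglongrightarrow> 0"
      using tendsto_enn2real[of "\<lambda>n. \<integral>\<^sup>+y. ennreal (d n y) \<partial>P" 0] lim by (simp add: d_def)
  qed
  moreover have "simple_integrable_in (rkhs k) P (s n)" for n
    using simple sec by (auto simp: simple_integrable_in_def s_def)
  ultimately show ?thesis
    unfolding has_bochner_integral_in_def \<Phi>_def[symmetric]
    using sec \<Phi> lim by (intro conjI exI[of _ s]) (auto simp: d d_def[symmetric])
qed

section \<open>Probability measures on nonseparable inner product spaces\<close>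

definition orthonormal :: "'a::real_inner set \<Rightarrow> bool" where
  "orthonormal F \<longleftrightarrow> (\<forall>e\<in>F. \<forall>f\<in>F. e \<bullet> f = (if e = f then 1 else 0))"

definition proj :: "'a::real_inner set \<Rightarrow> 'a \<Rightarrow> 'a" where
  "proj F x = (\<Sum>e\<in>F. (x \<bullet> e) *\<^sub>R e)"

lemma proj_adjoint: "proj F x \<bullet> v = x \<bullet> proj F v"
  by (simp add: proj_def inner_sum_left inner_sum_right inner_commute mult.commute)

lemma inner_diff_proj:
  assumes "finite F" "orthonormal F" "e \<in> F"
  shows "(x - proj F x) \<bullet> e = 0"
proof -
  have "proj F x \<bullet> e = (\<Sum>f\<in>F. if f = e then x \<bullet> f else 0)"
    unfolding proj_def inner_sum_left
    by (rule sum.cong) (use assms in \<open>auto simp: orthonormal_def\<close>)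
  thus ?thesis using assms by (simp add: inner_diff_left)
qed

lemma norm_diff_proj:
  assumes "finite F" "orthonormal F"
  shows "(norm (x - proj F x))\<^sup>2 = (norm x)\<^sup>2 - (\<Sum>e\<in>F. (x \<bullet> e)\<^sup>2)"
proof -
  have "(x - proj F x) \<bullet> proj F x = (\<Sum>e\<in>F. (x \<bullet> e) * ((x - proj F x) \<bullet> e))"
    by (subst (2) proj_def) (simp add: inner_sum_right)
  also have "\<dots> = 0" using inner_diff_proj[OF assms] by simp
  finally have "(norm (x - proj F x))\<^sup>2 = (x - proj F x) \<bullet> x"
    by (simp add: power2_norm_eq_inner inner_diff_right)
  also have "\<dots> = (norm x)\<^sup>2 - (\<Sum>e\<in>F. (x \<bullet> e)\<^sup>2)"
  proof -
    have "proj F x \<bullet> x = (\<Sum>e\<in>F. (x \<bullet> e)\<^sup>2)"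
      unfolding proj_def inner_sum_left inner_scaleR_left power2_eq_square by (simp add: inner_commute)
    thus ?thesis by (simp add: inner_diff_left power2_norm_eq_inner)
  qed
  finally show ?thesis .
qed

lemma bessel:
  assumes "finite F" "orthonormal F"
  shows "(\<Sum>e\<in>F. (x \<bullet> e)\<^sup>2) \<le> (norm x)\<^sup>2"
  using norm_diff_proj[OF assms, of x] zero_le_power2[of "norm (x - proj F x)"] by linarith

lemma norm_diff_proj_le:
  assumes "finite F" "orthonormal F"
  shows "norm (x - proj F x) \<le> norm x"
proof (rule power2_le_imp_le)
  show "(norm (x - proj F x))\<^sup>2 \<le> (norm x)\<^sup>2"
    using norm_diff_proj[OF assms, of x] by (simp add: sum_nonneg)
qed simp

text \<open>
  A quadratic form whose trace is bounded by \<open>C\<close> is uniformly small off a finite-dimensional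
  subspace: otherwise more than \<open>C / \<epsilon>\<close> orthonormal vectors on which it exceeds \<open>\<epsilon>\<close> could be found.
\<close>

lemma trace_class_small:
  fixes B :: "'a::real_inner \<Rightarrow> real"
  assumes scale: "\<And>c x. B (c *\<^sub>R x) = c\<^sup>2 * B x"
    and trace: "\<And>F. finite F \<Longrightarrow> orthonormal F \<Longrightarrow> sum B F \<le> C"
    and \<epsilon>: "0 < \<epsilon>"
  obtains F where "finite F" "orthonormal F" "\<And>z. (\<And>e. e \<in> F \<Longrightarrow> z \<bullet> e = 0) \<Longrightarrow> B z \<le> \<epsilon> * (norm z)\<^sup>2"
proof (rule ccontr)
  assume "\<not> thesis"
  hence ex: "\<exists>z. (\<forall>e\<in>F. z \<bullet> e = 0) \<and> \<epsilon> * (norm z)\<^sup>2 < B z" if "finite F" "orthonormal F" for F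
    using that \<open>\<And>F. \<lbrakk>finite F; orthonormal F; \<And>z. (\<And>e. e \<in> F \<Longrightarrow> z \<bullet> e = 0) \<Longrightarrow> B z \<le> \<epsilon> * (norm z)\<^sup>2\<rbrakk> \<Longrightarrow> thesis\<close>
    by (meson not_le)
  have big: "\<exists>F. finite F \<and> orthonormal F \<and> card F = n \<and> (\<forall>e\<in>F. \<epsilon> < B e)" for n
  proof (induction n)
    case 0
    show ?case by (intro exI[of _ "{}"]) (auto simp: orthonormal_def)
  next
    case (Suc n)
    then obtain F where F: "finite F" "orthonormal F" "card F = n" "\<forall>e\<in>F. \<epsilon> < B e" by blast
    obtain z where z: "\<forall>e\<in>F. z \<bullet> e = 0" "\<epsilon> * (norm z)\<^sup>2 < B z" using ex[OF F(1,2)] by blast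
    \<comment> \<open>Scaling by 0 gives \<open>B 0 = 0\<close>, which the strict inequality
      excludes.\<close>
    have "z \<noteq> 0" using z(2) scale[of 0 z] by auto
    define u where "u = (1 / norm z) *\<^sub>R z"
    have "u \<bullet> u = 1" using \<open>z \<noteq> 0\<close> by (simp add: u_def power2_norm_eq_inner[symmetric] power2_eq_square)
    moreover have ue: "\<forall>e\<in>F. u \<bullet> e = 0" using z(1) by (simp add: u_def)
    moreover have "\<epsilon> < B u"
      using z(2) \<open>z \<noteq> 0\<close> by (simp add: u_def scale power_divide pos_less_divide_eq)
    moreover have "u \<notin> F" using \<open>u \<bullet> u = 1\<close> ue by auto
    ultimately show ?case using F
      by (intro exI[of _ "insert u F"]) (auto simp: orthonormal_def inner_commute)
  qed
  obtain n :: nat where n: "C / \<epsilon> < real n" using reals_Archimedean2 by blast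
  obtain F where F: "finite F" "orthonormal F" "card F = n" "\<forall>e\<in>F. \<epsilon> < B e" using big by blast
  have "real n * \<epsilon> = (\<Sum>e\<in>F. \<epsilon>)" using F by simp
  also have "\<dots> \<le> sum B F" using F by (intro sum_mono) auto
  also have "\<dots> \<le> C" by (rule trace[OF F(1,2)])
  finally show False using n \<epsilon> by (simp add: field_simps)
qed

text \<open>
  The weight makes the covariance form of an arbitrary probability measure trace class.
\<close>

definition weighted_cov :: "'a::real_inner measure \<Rightarrow> 'a \<Rightarrow> real" where
  "weighted_cov M x = (\<integral>v. (x \<bullet> v)\<^sup>2 / (1 + (norm v)\<^sup>2) \<partial>M)"

lemma borel_measurable_borel_prob:
  fixes f :: "'a::topological_space \<Rightarrow> 'b::topological_space"
  assumes "borel_prob M" "f \<in> borel_measurable borel"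
  shows "f \<in> borel_measurable M"
  using assms by (simp add: borel_prob_def cong: measurable_cong_sets)

lemma integrable_weighted_cov:
  assumes M: "borel_prob (M :: 'a::real_inner measure)"
  shows "integrable M (\<lambda>v. (x \<bullet> v)\<^sup>2 / (1 + (norm v)\<^sup>2))"
proof -
  interpret prob_space M using M by (simp add: borel_prob_def)
  show ?thesis
  proof (rule integrable_const_bound[where B = "(norm x)\<^sup>2"])
    have "(x \<bullet> v)\<^sup>2 \<le> (norm x)\<^sup>2 * (1 + (norm v)\<^sup>2)" for v
    proof -
      have "(x \<bullet> v)\<^sup>2 \<le> (norm x * norm v)\<^sup>2" by (rule abs_le_square_iff[THEN iffD1]) (simp add: Cauchy_Schwarz_ineq2)
      also have "\<dots> \<le> (norm x)\<^sup>2 * (1 + (norm v)\<^sup>2)" by (simp add: power_mult_distrib distrib_left)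
      finally show ?thesis .
    qed
    thus "AE v in M. norm ((x \<bullet> v)\<^sup>2 / (1 + (norm v)\<^sup>2)) \<le> (norm x)\<^sup>2"
      by (intro AE_I2) (simp add: pos_divide_le_eq add_pos_nonneg)
    have "1 + (norm v)\<^sup>2 \<noteq> 0" for v :: 'a using add_pos_nonneg[of 1 "(norm v)\<^sup>2"] by simp
    thus "(\<lambda>v. (x \<bullet> v)\<^sup>2 / (1 + (norm v)\<^sup>2)) \<in> borel_measurable M"
      by (intro borel_measurable_borel_prob[OF M] borel_measurable_continuous_onI continuous_intros) auto
  qed
qed

lemma weighted_cov_scale: "weighted_cov M (c *\<^sub>R x) = c\<^sup>2 * weighted_cov M x"
  unfolding weighted_cov_def by (simp add: power_mult_distrib times_divide_eq_right[symmetric] del: times_divide_eq_right)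

lemma weighted_cov_nonneg: "0 \<le> weighted_cov M x"
  by (auto simp: weighted_cov_def intro!: integral_nonneg_AE)

text \<open>By Bessel's inequality the integrands of the vectors in \<open>F\<close> add up to at
  most \<open>(norm v)\<^sup>2 / (1 + (norm v)\<^sup>2)\<close>, whatever the size of
  \<open>F\<close>.\<close>

lemma weighted_cov_trace:
  assumes M: "borel_prob M" and F: "finite F" "orthonormal F"
  shows "sum (weighted_cov M) F \<le> 1"
proof -
  interpret prob_space M using M by (simp add: borel_prob_def)
  have "sum (weighted_cov M) F = (\<integral>v. (\<Sum>e\<in>F. (e \<bullet> v)\<^sup>2 / (1 + (norm v)\<^sup>2)) \<partial>M)"
    unfolding weighted_cov_def
    by (intro Bochner_Integration.integral_sum[symmetric] integrable_weighted_cov M)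
  also have "\<dots> \<le> (\<integral>v. 1 \<partial>M)"
  proof (rule integral_mono)
    fix v
    have "(\<Sum>e\<in>F. (e \<bullet> v)\<^sup>2) \<le> 1 + (norm v)\<^sup>2" using bessel[OF F, of v] by (simp add: inner_commute)
    thus "(\<Sum>e\<in>F. (e \<bullet> v)\<^sup>2 / (1 + (norm v)\<^sup>2)) \<le> 1"
      by (simp add: sum_divide_distrib[symmetric] pos_divide_le_eq add_pos_nonneg)
  qed (intro Bochner_Integration.integrable_sum integrable_weighted_cov M, simp)
  finally show ?thesis by (simp add: prob_space)
qed

text \<open>A Borel-Cantelli argument: the integrals of the weighted squares are summable, so almost
  everywhere the squares are summable and tend to 0. The weight at \<open>v\<close> does not depend
  on \<open>n\<close> and is cancelled at the end.\<close>

lemma AE_tendsto_0_of_weighted_cov: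
  assumes M: "borel_prob M" and b: "\<And>n. weighted_cov M (z n) \<le> C * (1 / 2) ^ n"
  shows "AE v in M. (\<lambda>n. z n \<bullet> v) \<longlonglongrightarrow> 0"
proof -
  define q where "q n v = (z n \<bullet> v)\<^sup>2 / (1 + (norm v)\<^sup>2)" for n v
  have q_int: "integrable M (q n)" for n
    unfolding q_def by (rule integrable_weighted_cov[OF M])
  have q: "0 \<le> q n v" for n v by (simp add: q_def)
  have "(\<integral>\<^sup>+v. (\<Sum>n. ennreal (q n v)) \<partial>M) = (\<Sum>n. \<integral>\<^sup>+v. ennreal (q n v) \<partial>M)"
    using q_int by (intro nn_integral_suminf) auto
  also have "\<dots> = (\<Sum>n. ennreal (weighted_cov M (z n)))"
  proof (intro arg_cong[where f = suminf] ext)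
    show "(\<integral>\<^sup>+v. ennreal (q n v) \<partial>M) = ennreal (weighted_cov M (z n))" for n
      using nn_integral_eq_integral[OF q_int[of n]] q[of n] unfolding weighted_cov_def q_def by blast
  qed
  also have "\<dots> \<le> (\<Sum>n. ennreal (C * (1 / 2) ^ n))"
    by (intro suminf_le ennreal_leI b) auto
  also have "\<dots> = ennreal (\<Sum>n. C * (1 / 2) ^ n)"
  proof (rule suminf_ennreal2)
    show "0 \<le> C * (1 / 2) ^ n" for n using b[of n] weighted_cov_nonneg[of M "z n"] by linarith
    show "summable (\<lambda>n. C * (1 / 2) ^ n)" by (intro summable_mult summable_geometric) simp
  qed
  also have "\<dots> < \<infinity>" by simp
  finally have "(\<integral>\<^sup>+v. (\<Sum>n. ennreal (q n v)) \<partial>M) \<noteq> \<infinity>" by simp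
  hence "AE v in M. (\<Sum>n. ennreal (q n v)) \<noteq> \<infinity>"
    using q_int by (intro nn_integral_PInf_AE) auto
  thus ?thesis
  proof eventually_elim
    case (elim v)
    hence "summable (\<lambda>n. q n v)" using q by (intro summable_suminf_not_top) auto
    hence "(\<lambda>n. q n v) \<longlonglongrightarrow> 0" by (rule summable_LIMSEQ_zero)
    hence "(\<lambda>n. sqrt (q n v * (1 + (norm v)\<^sup>2))) \<longlonglongrightarrow> sqrt (0 * (1 + (norm v)\<^sup>2))"
      by (intro tendsto_intros)
    moreover have "sqrt (q n v * (1 + (norm v)\<^sup>2)) = \<bar>z n \<bullet> v\<bar>" for n
      using add_pos_nonneg[of 1 "(norm v)\<^sup>2"] by (simp add: q_def)
    ultimately show ?case by (simp add: tendsto_rabs_zero_iff)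
  qed
qed

section \<open>Weak approximation by simple functions\<close>

definition discretize :: "nat \<Rightarrow> real \<Rightarrow> real" where
  "discretize m t = (if \<bar>t\<bar> \<le> real m then of_int \<lfloor>2 ^ m * t\<rfloor> / 2 ^ m else 0)"

lemma discretize_close: "\<bar>t\<bar> \<le> real m \<Longrightarrow> \<bar>discretize m t - t\<bar> \<le> (1 / 2) ^ m"
proof -
  assume t: "\<bar>t\<bar> \<le> real m"
  have "discretize m t - t = (of_int \<lfloor>2 ^ m * t\<rfloor> - 2 ^ m * t) / 2 ^ m"
    using t by (simp add: discretize_def diff_divide_distrib)
  hence "\<bar>discretize m t - t\<bar> = \<bar>of_int \<lfloor>2 ^ m * t\<rfloor> - 2 ^ m * t\<bar> / 2 ^ m" by simp
  also have "\<dots> \<le> 1 / 2 ^ m" by (rule divide_right_mono) (linarith, simp)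
  finally show ?thesis by (simp add: power_divide)
qed

lemma simple_function_discretize: "simple_function borel (discretize m)"
proof (rule simple_function_borel_measurable)
  show "discretize m \<in> borel_measurable borel" unfolding discretize_def by measurable
  have "range (discretize m) \<subseteq> (\<lambda>i. of_int i / 2 ^ m) ` {\<lfloor>- (2 ^ m * real m)\<rfloor>..\<lfloor>2 ^ m * real m\<rfloor>}"
  proof
    fix r assume "r \<in> range (discretize m)"
    then obtain t where r: "r = discretize m t" by auto
    show "r \<in> (\<lambda>i. of_int i / 2 ^ m) ` {\<lfloor>- (2 ^ m * real m)\<rfloor>..\<lfloor>2 ^ m * real m\<rfloor>}"
    proof (cases "\<bar>t\<bar> \<le> real m")
      case True
      hence "2 ^ m * t \<le> 2 ^ m * real m" "2 ^ m * (- real m) \<le> 2 ^ m * t"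
        by (intro mult_left_mono; simp)+
      thus ?thesis using True unfolding r discretize_def
        by (auto intro!: image_eqI[where x = "\<lfloor>2 ^ m * t\<rfloor>"] floor_mono)
    next
      case False
      have "\<lfloor>- (2 ^ m * real m)\<rfloor> \<le> 0" using floor_mono[of "- (2 ^ m * real m)" 0] by simp
      thus ?thesis using False unfolding r discretize_def by (auto intro!: image_eqI[where x = 0])
    qed
  qed
  thus "finite (discretize m ` space borel)" by (simp add: finite_subset)
qed

text \<open>
  The space is not assumed separable, so \<open>(y, v) \<mapsto> y \<bullet> v\<close> need not be measurable for the product
  \<open>\<sigma>\<close>-algebra. Probability measures nevertheless see only a separable part of it: up to null sets
  the inner product is a limit of product-measurable functions.
\<close>

lemma simple_weak_approximation:
  fixes P Q :: "'a::real_inner measure"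
  assumes P: "borel_prob P" and Q: "borel_prob Q"
  obtains \<tau> :: "nat \<Rightarrow> 'a \<Rightarrow> 'a" where "\<And>n. simple_function borel (\<tau> n)"
    "\<And>y. AE v in Q. (\<lambda>n. \<tau> n y \<bullet> v) \<longlonglongrightarrow> y \<bullet> v"
    "\<And>v. AE y in P. (\<lambda>n. \<tau> n y \<bullet> v) \<longlonglongrightarrow> y \<bullet> v"
proof -
  \<comment> \<open>With the sum of both forms, one sequence of subspaces serves \<open>P\<close>
    and \<open>Q\<close> at once.\<close>
  define B where "B x = weighted_cov P x + weighted_cov Q x" for x
  have "\<exists>F. finite F \<and> orthonormal F \<and> (\<forall>z. (\<forall>e\<in>F. z \<bullet> e = 0) \<longrightarrow> B z \<le> (1 / 2) ^ n * (norm z)\<^sup>2)" for n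
  proof -
    have "B (c *\<^sub>R x) = c\<^sup>2 * B x" for c x by (simp add: B_def weighted_cov_scale distrib_left)
    moreover have "sum B F \<le> 2" if "finite F" "orthonormal F" for F
      using weighted_cov_trace[OF P that] weighted_cov_trace[OF Q that] by (simp add: B_def sum.distrib)
    ultimately obtain F where "finite F" "orthonormal F"
        "\<And>z. (\<And>e. e \<in> F \<Longrightarrow> z \<bullet> e = 0) \<Longrightarrow> B z \<le> (1 / 2) ^ n * (norm z)\<^sup>2"
      by (rule trace_class_small[of B 2 "(1 / 2) ^ n"]) auto
    thus ?thesis by (intro exI[of _ F]) auto
  qed
  then obtain F where F: "\<And>n. finite (F n)" "\<And>n. orthonormal (F n)"
    and small: "\<And>n z. (\<forall>e\<in>F n. z \<bullet> e = 0) \<Longrightarrow> B z \<le> (1 / 2) ^ n * (norm z)\<^sup>2" by metis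
  have Bproj: "B (x - proj (F n) x) \<le> (norm x)\<^sup>2 * (1 / 2) ^ n" for n x
  proof -
    have "B (x - proj (F n) x) \<le> (1 / 2) ^ n * (norm (x - proj (F n) x))\<^sup>2"
      by (intro small ballI inner_diff_proj F)
    also have "\<dots> \<le> (1 / 2) ^ n * (norm x)\<^sup>2"
      by (intro mult_left_mono power_mono norm_diff_proj_le F) auto
    finally show ?thesis by (simp add: mult.commute)
  qed
  have AE_proj: "AE v in M. (\<lambda>n. (x - proj (F n) x) \<bullet> v) \<longlonglongrightarrow> 0" if "M = P \<or> M = Q" for M x
  proof (rule AE_tendsto_0_of_weighted_cov)
    show "borel_prob M" using that P Q by auto
    show "weighted_cov M (x - proj (F n) x) \<le> (norm x)\<^sup>2 * (1 / 2) ^ n" for n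
      using that Bproj[of x n] weighted_cov_nonneg[of P "x - proj (F n) x"]
        weighted_cov_nonneg[of Q "x - proj (F n) x"] by (auto simp: B_def)
  qed
  \<comment> \<open>A cutoff of at least \<open>n\<close> eventually contains all coordinates of
    \<open>y\<close>. The additional \<open>card (F n)\<close> bits of precision absorb the number
    of summands, since \<open>c \<le> 2 ^ c\<close>.\<close>
  define m where "m n = n + card (F n)" for n
  define \<tau> where "\<tau> n y = (\<Sum>e\<in>F n. discretize (m n) (y \<bullet> e) *\<^sub>R e)" for n y
  have close: "norm (\<tau> n y - proj (F n) y) \<le> (1 / 2) ^ n" if n: "norm y \<le> real n" for n y
  proof -
    have "norm (\<tau> n y - proj (F n) y) \<le> (\<Sum>e\<in>F n. norm ((discretize (m n) (y \<bullet> e) - y \<bullet> e) *\<^sub>R e))"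
      unfolding \<tau>_def proj_def sum_subtractf[symmetric] scaleR_diff_left[symmetric] by (rule norm_sum)
    also have "\<dots> \<le> (\<Sum>e\<in>F n. (1 / 2) ^ m n)"
    proof (rule sum_mono)
      fix e assume e: "e \<in> F n"
      hence "norm e = 1" using F(2)[of n] by (simp add: orthonormal_def norm_eq_1)
      moreover from this have "\<bar>y \<bullet> e\<bar> \<le> real (m n)" using Cauchy_Schwarz_ineq2[of y e] n by (simp add: m_def)
      ultimately show "norm ((discretize (m n) (y \<bullet> e) - y \<bullet> e) *\<^sub>R e) \<le> (1 / 2) ^ m n"
        using discretize_close by simp
    qed
    also have "\<dots> = (1 / 2) ^ n * (real (card (F n)) / 2 ^ card (F n))"
      by (simp add: m_def power_add power_divide)
    also have "\<dots> \<le> (1 / 2) ^ n * 1"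
    proof (intro mult_left_mono)
      have "card (F n) \<le> 2 ^ card (F n)" using less_exp[of "card (F n)"] by simp
      hence "real (card (F n)) \<le> 2 ^ card (F n)" by (metis of_nat_le_iff of_nat_numeral of_nat_power)
      thus "real (card (F n)) / 2 ^ card (F n) \<le> 1" by simp
    qed simp
    finally show ?thesis by simp
  qed
  have err: "(\<lambda>n. (\<tau> n y - proj (F n) y) \<bullet> v) \<longlonglongrightarrow> 0" for y v
  proof (rule Lim_null_comparison)
    show "(\<lambda>n. (1 / 2) ^ n * norm v) \<longlonglongrightarrow> 0"
      by (intro tendsto_mult_left_zero LIMSEQ_power_zero) simp
    show "\<forall>\<^sub>F n in sequentially. norm ((\<tau> n y - proj (F n) y) \<bullet> v) \<le> (1 / 2) ^ n * norm v"
      using eventually_ge_at_top[of "nat \<lceil>norm y\<rceil>"]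
    proof eventually_elim
      case (elim n)
      hence "norm y \<le> real n" by linarith
      from close[OF this] show ?case
        using Cauchy_Schwarz_ineq2[of "\<tau> n y - proj (F n) y" v] mult_right_mono[OF close[OF \<open>norm y \<le> real n\<close>], of "norm v"]
        by simp
    qed
  qed
  have \<tau>_lim: "(\<lambda>n. \<tau> n y \<bullet> v) \<longlonglongrightarrow> y \<bullet> v" if "(\<lambda>n. (y - proj (F n) y) \<bullet> v) \<longlonglongrightarrow> 0" for y v
  proof -
    have "(\<lambda>n. y \<bullet> v + (\<tau> n y - proj (F n) y) \<bullet> v - (y - proj (F n) y) \<bullet> v) \<longlonglongrightarrow> y \<bullet> v + 0 - 0"
      by (intro tendsto_intros err that)
    thus ?thesis by (simp add: inner_diff_left)
  qed
  show ?thesis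
  proof
    show "simple_function borel (\<tau> n)" for n
    proof -
      have "simple_function borel (\<lambda>y. discretize (m n) (y \<bullet> e) *\<^sub>R e)" for e :: 'a
      proof -
        have "(\<lambda>y. y \<bullet> e) \<in> borel_measurable borel"
          by (intro borel_measurable_continuous_onI continuous_intros)
        from simple_function_comp[OF this simple_function_discretize]
        have "simple_function borel (\<lambda>y. discretize (m n) (y \<bullet> e))" by simp
        from simple_function_compose1[OF this, of "\<lambda>r. r *\<^sub>R e"] show ?thesis .
      qed
      thus ?thesis unfolding \<tau>_def by (intro simple_function_sum)
    qed
    show "AE v in Q. (\<lambda>n. \<tau> n y \<bullet> v) \<longlonglongrightarrow> y \<bullet> v" for y
      using AE_proj[of Q y] by (auto intro: \<tau>_lim)
    \<comment> \<open>For fixed \<open>v\<close> the roles are exchanged: \<open>proj\<close> is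
      self-adjoint, so the projection error of \<open>y\<close> tested with \<open>v\<close> is that
      of \<open>v\<close> tested with \<open>y\<close>.\<close>
    show "AE y in P. (\<lambda>n. \<tau> n y \<bullet> v) \<longlonglongrightarrow> y \<bullet> v" for v
    proof -
      have "(v - proj (F n) v) \<bullet> y = (y - proj (F n) y) \<bullet> v" for y n
        by (simp add: inner_diff_left inner_diff_right inner_commute[of _ y] proj_adjoint inner_commute[of v y])
      thus ?thesis using AE_proj[of P v] by (auto intro: \<tau>_lim)
    qed
  qed
qed

section \<open>Scale mixtures and depth\<close>

text \<open>On each of the finitely many level sets of \<open>\<tau>\<close> only one section
  \<open>f c\<close> occurs. This yields measurability for the product of the sigma-algebras, which
  in a nonseparable space may be smaller than the Borel sets of the product.\<close>

lemma measurable_simple_section: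
  assumes \<tau>: "simple_function M \<tau>" and f: "\<And>c. f c \<in> measurable N L"
  shows "(\<lambda>(y, v). f (\<tau> y) v) \<in> measurable (M \<Otimes>\<^sub>M N) L"
proof -
  have "(\<lambda>p. f (\<tau> (fst p)) (snd p)) \<in> measurable (M \<Otimes>\<^sub>M N) L"
  proof (rule measurable_compose_countable'[where I = "\<tau> ` space M" and f = "\<lambda>c p. f c (snd p)"])
    show "(\<lambda>p. f c (snd p)) \<in> measurable (M \<Otimes>\<^sub>M N) L" for c
      using measurable_compose[OF measurable_snd f] .
    show "(\<lambda>p. \<tau> (fst p)) \<in> measurable (M \<Otimes>\<^sub>M N) (count_space (\<tau> ` space M))"
      using \<tau> by (intro measurable_compose[OF measurable_fst])
        (auto simp: simple_function_def measurable_count_space_eq2)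
    show "countable (\<tau> ` space M)"
      using \<tau> by (auto simp: simple_function_def intro: countable_finite)
  qed
  thus ?thesis by (simp add: split_beta)
qed

text \<open>The pair of \<open>U\<close> and \<open>V\<close> need not be Borel measurable in the
  product space, so continuity of scalar multiplication does not suffice. Rounding \<open>U\<close>
  to multiples of \<open>1 / n\<close> leaves countably many continuous maps of \<open>V\<close>,
  and the products converge pointwise.\<close>

lemma borel_measurable_scaleR_nonseparable:
  fixes V :: "'w \<Rightarrow> 'a::real_normed_vector"
  assumes U [measurable]: "U \<in> borel_measurable M" and V [measurable]: "V \<in> borel_measurable M"
  shows "(\<lambda>\<omega>. U \<omega> *\<^sub>R V \<omega>) \<in> borel_measurable M"
proof (rule borel_measurable_LIMSEQ_metric)
  fix n
  show "(\<lambda>\<omega>. (of_int \<lfloor>real n * U \<omega>\<rfloor> / real n) *\<^sub>R V \<omega>) \<in> borel_measurable M"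
  proof (rule measurable_compose_countable[where f = "\<lambda>i \<omega>. (of_int i / real n) *\<^sub>R V \<omega>"])
    show "(\<lambda>\<omega>. (of_int i / real n) *\<^sub>R V \<omega>) \<in> borel_measurable M" for i :: int
      by (rule measurable_compose[OF V]) (intro borel_measurable_continuous_onI continuous_intros)
    show "(\<lambda>\<omega>. \<lfloor>real n * U \<omega>\<rfloor>) \<in> measurable M (count_space UNIV)" by measurable
  qed
next
  fix \<omega>
  have "(\<lambda>n. of_int \<lfloor>real n * U \<omega>\<rfloor> / real n) \<longlonglongrightarrow> U \<omega>"
  proof (rule LIMSEQ_I)
    fix e :: real assume e: "0 < e"
    then obtain N :: nat where N: "1 / e < real N" using reals_Archimedean2 by blast
    show "\<exists>N. \<forall>n\<ge>N. norm (of_int \<lfloor>real n * U \<omega>\<rfloor> / real n - U \<omega>) < e"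
    proof (intro exI allI impI)
      fix n assume "N \<le> n"
      hence n: "1 / e < real n" using N by linarith
      hence n0: "0 < real n" using e by (meson divide_pos_pos less_trans zero_less_one)
      have "norm (of_int \<lfloor>real n * U \<omega>\<rfloor> / real n - U \<omega>) = \<bar>of_int \<lfloor>real n * U \<omega>\<rfloor> - real n * U \<omega>\<bar> / real n"
      proof -
        have "of_int \<lfloor>real n * U \<omega>\<rfloor> / real n - U \<omega> = (of_int \<lfloor>real n * U \<omega>\<rfloor> - real n * U \<omega>) / real n"
          using n0 by (simp add: diff_divide_distrib)
        thus ?thesis by simp
      qed
      also have "\<dots> \<le> 1 / real n" by (rule divide_right_mono) (linarith, simp)
      also have "\<dots> < e" using n n0 e by (simp add: field_simps)
      finally show "norm (of_int \<lfloor>real n * U \<omega>\<rfloor> / real n - U \<omega>) < e" .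
    qed
  qed
  thus "(\<lambda>n. (of_int \<lfloor>real n * U \<omega>\<rfloor> / real n) *\<^sub>R V \<omega>) \<longlonglongrightarrow> U \<omega> *\<^sub>R V \<omega>"
    by (intro tendsto_intros)
qed

section \<open>Independent factors and Fourier transforms\<close>

lemma indep_rvs_distr_pair:
  assumes M: "prob_space M" and indep: "indep_rvs M U V"
  shows "distr M (borel \<Otimes>\<^sub>M borel) (\<lambda>\<omega>. (U \<omega>, V \<omega>)) = distr M borel U \<Otimes>\<^sub>M distr M borel V"
proof -
  interpret prob_space M by (rule M)
  have U [measurable]: "U \<in> borel_measurable M" and V [measurable]: "V \<in> borel_measurable M"
    and ind: "indep_set {U -` A \<inter> space M | A. A \<in> sets borel} {V -` B \<inter> space M | B. B \<in> sets borel}"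
    using indep by (auto simp: indep_rvs_def)
  interpret U: prob_space "distr M borel U" by (rule prob_space_distr) measurable
  interpret V: prob_space "distr M borel V" by (rule prob_space_distr) measurable
  show ?thesis
  \<comment> \<open>A product measure is determined by its values on rectangles, where the claim is
    the product rule for independent events.\<close>
  proof (rule pair_measure_eqI[symmetric])
    show "sigma_finite_measure (distr M borel U)" "sigma_finite_measure (distr M borel V)" by unfold_locales
    show "sets (distr M borel U \<Otimes>\<^sub>M distr M borel V) = sets (distr M (borel \<Otimes>\<^sub>M borel) (\<lambda>\<omega>. (U \<omega>, V \<omega>)))"
      by (simp cong: sets_pair_measure_cong)
    fix A B assume "A \<in> sets (distr M borel U)" "B \<in> sets (distr M borel V)"
    hence [measurable]: "A \<in> sets borel" "B \<in> sets borel" by auto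
    have "prob ((U -` A \<inter> space M) \<inter> (V -` B \<inter> space M)) = prob (U -` A \<inter> space M) * prob (V -` B \<inter> space M)"
      by (rule indep_setD[OF ind]) auto
    moreover have "(\<lambda>\<omega>. (U \<omega>, V \<omega>)) -` (A \<times> B) \<inter> space M = (U -` A \<inter> space M) \<inter> (V -` B \<inter> space M)" by auto
    ultimately show "emeasure (distr M borel U) A * emeasure (distr M borel V) B =
        emeasure (distr M (borel \<Otimes>\<^sub>M borel) (\<lambda>\<omega>. (U \<omega>, V \<omega>))) (A \<times> B)"
      by (simp add: emeasure_distr emeasure_eq_measure ennreal_mult)
  qed
qed

text \<open>As \<open>z \<bullet> (U V) = (z \<bullet> V) U\<close>, the vector enters only through
  the real number \<open>z \<bullet> V\<close>. The integrand is therefore product-measurable, and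
  Fubini's theorem integrates out \<open>U\<close> first.\<close>

lemma fourier_transform_scale_mixture:
  fixes V :: "'w \<Rightarrow> 'a::real_inner"
  assumes M: "prob_space M" and indep: "indep_rvs M U V"
  shows "fourier_transform (distr M borel (\<lambda>\<omega>. U \<omega> *\<^sub>R V \<omega>)) z =
    (CLINT v|distr M borel V. fourier_transform (distr M borel U) (z \<bullet> v))"
proof -
  interpret prob_space M by (rule M)
  have U [measurable]: "U \<in> borel_measurable M" and V [measurable]: "V \<in> borel_measurable M"
    using indep by (auto simp: indep_rvs_def)
  have UV [measurable]: "(\<lambda>\<omega>. U \<omega> *\<^sub>R V \<omega>) \<in> borel_measurable M"
    by (rule borel_measurable_scaleR_nonseparable) measurable
  interpret U: prob_space "distr M borel U" by (rule prob_space_distr) measurable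
  interpret V: prob_space "distr M borel V" by (rule prob_space_distr) measurable
  interpret UV: pair_prob_space "distr M borel U" "distr M borel V" ..
  have [measurable]: "(\<lambda>v. z \<bullet> v) \<in> borel_measurable borel"
    by (intro borel_measurable_continuous_onI continuous_intros)
  have exp_meas: "(\<lambda>v. exp (\<i> * complex_of_real (z \<bullet> v))) \<in> borel_measurable borel" by measurable
  define f where "f = (\<lambda>(u::real, v). exp (\<i> * complex_of_real ((z \<bullet> v) * u)))"
  have f [measurable]: "f \<in> borel_measurable (borel \<Otimes>\<^sub>M borel)" unfolding f_def by measurable
  have "fourier_transform (distr M borel (\<lambda>\<omega>. U \<omega> *\<^sub>R V \<omega>)) z = (CLINT \<omega>|M. f (U \<omega>, V \<omega>))"
    unfolding fourier_transform_def by (subst integral_distr[OF UV exp_meas]) (simp add: f_def mult.commute)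
  also have "\<dots> = integral\<^sup>L (distr M (borel \<Otimes>\<^sub>M borel) (\<lambda>\<omega>. (U \<omega>, V \<omega>))) f"
    by (subst integral_distr) auto
  also have "\<dots> = integral\<^sup>L (distr M borel U \<Otimes>\<^sub>M distr M borel V) f"
    by (simp only: indep_rvs_distr_pair[OF M indep])
  also have "\<dots> = (CLINT v|distr M borel V. CLINT u|distr M borel U. f (u, v))"
  proof -
    have "integrable (distr M borel U \<Otimes>\<^sub>M distr M borel V) f"
    proof (rule UV.P.integrable_const_bound[where B = 1])
      show "f \<in> borel_measurable (distr M borel U \<Otimes>\<^sub>M distr M borel V)"
        using f by (simp cong: measurable_cong_sets sets_pair_measure_cong)
    qed (auto simp: f_def)
    hence "integrable (distr M borel U \<Otimes>\<^sub>M distr M borel V) (case_prod (\<lambda>u v. f (u, v)))" by simp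
    from UV.integral_snd[OF this] show ?thesis by simp
  qed
  finally show ?thesis by (simp add: f_def fourier_transform_def)
qed

section \<open>Positive definiteness and the depth formula\<close>

lemma borel_measurable_compose_inner:
  assumes "borel_prob \<mu>" "continuous_on UNIV g"
  shows "(\<lambda>v. g (x \<bullet> v)) \<in> borel_measurable \<mu>"
  by (intro borel_measurable_borel_prob[OF assms(1)] borel_measurable_continuous_onI
      continuous_on_compose2[OF assms(2)] continuous_intros) auto

text \<open>As \<open>k\<close> is real, only the cosine part of the transform remains, and the
  addition formula writes the quadratic form as an integral of a sum of two squares.\<close>

lemma fourier_kernel_pos_def:
  fixes \<mu> :: "'a::real_inner measure"
  assumes \<mu>: "borel_prob \<mu>"
    and k: "\<And>x y. complex_of_real (k x y) = fourier_transform \<mu> (x - y)"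
  shows "is_kernel k"
proof -
  interpret prob_space \<mu> using \<mu> by (simp add: borel_prob_def)
  note meas = borel_measurable_compose_inner[OF \<mu>]
  have k_cos: "k x y = (\<integral>v. cos ((x - y) \<bullet> v) \<partial>\<mu>)" for x y
  proof -
    have "integrable \<mu> (\<lambda>v. exp (\<i> * complex_of_real ((x - y) \<bullet> v)))"
      by (rule integrable_const_bound[where B = 1])
        (auto intro!: meas[where g = "\<lambda>t. exp (\<i> * complex_of_real t)"] continuous_intros)
    from integral_Re[OF this] show ?thesis
      using arg_cong[OF k[of x y], of Re] by (simp add: fourier_transform_def Re_exp)
  qed
  show ?thesis
    unfolding is_kernel_def
  proof (intro conjI allI)
    show "k x y = k y x" for x y
    proof -
      have "cos ((x - y) \<bullet> v) = cos ((y - x) \<bullet> v)" for v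
        by (metis cos_minus inner_minus_left minus_diff_eq)
      thus ?thesis by (simp add: k_cos)
    qed
    fix n :: nat and a :: "nat \<Rightarrow> real" and x :: "nat \<Rightarrow> 'a"
    have "(\<Sum>i<n. \<Sum>j<n. a i * a j * k (x i) (x j)) =
        (\<integral>v. (\<Sum>i<n. \<Sum>j<n. a i * a j * cos ((x i - x j) \<bullet> v)) \<partial>\<mu>)"
    proof -
      have int: "integrable \<mu> (\<lambda>v. a i * a j * cos ((x i - x j) \<bullet> v))" for i j
        by (intro integrable_mult_right integrable_const_bound[where B = 1])
          (auto intro!: meas continuous_intros)
      have "(\<integral>v. (\<Sum>i<n. \<Sum>j<n. a i * a j * cos ((x i - x j) \<bullet> v)) \<partial>\<mu>) =
          (\<Sum>i<n. \<Sum>j<n. \<integral>v. a i * a j * cos ((x i - x j) \<bullet> v) \<partial>\<mu>)"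
        by (simp only: Bochner_Integration.integral_sum Bochner_Integration.integrable_sum int)
      thus ?thesis unfolding k_cos by (simp only: integral_mult_right_zero)
    qed
    also have "\<dots> = (\<integral>v. (\<Sum>i<n. a i * cos (x i \<bullet> v))\<^sup>2 + (\<Sum>i<n. a i * sin (x i \<bullet> v))\<^sup>2 \<partial>\<mu>)"
      by (simp add: power2_eq_square sum_product inner_diff_left cos_diff distrib_left mult_ac flip: sum.distrib)
    also have "0 \<le> \<dots>" by (intro integral_nonneg_AE AE_I2) simp
    finally show "0 \<le> (\<Sum>i<n. \<Sum>j<n. a i * a j * k (x i) (x j))" .
  qed
qed

theorem theorem4:
  fixes P \<nu> :: "'a::{real_inner, complete_space} measure"
    and \<kappa>\<^sub>1 :: "real \<Rightarrow> real"
  assumes "borel_prob P" and "borel_prob \<nu>"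
    and "\<And>t. 0 \<le> t \<Longrightarrow> 0 \<le> \<kappa>\<^sub>1 t"
    and "continuous_on {0..} \<kappa>\<^sub>1"
    and "antimono_on {0..} \<kappa>\<^sub>1"
    and "0 < \<kappa>\<^sub>1 0"
    and "(\<kappa>\<^sub>1 \<longlongrightarrow> 0) at_top"
    and "completely_monotone (\<lambda>t. \<kappa>\<^sub>1 (sqrt t))"
  shows "(\<exists>\<mu>\<^sub>1. represented_by \<kappa>\<^sub>1 \<mu>\<^sub>1) \<and>
    (\<forall>\<mu>\<^sub>1 (M :: 'w measure) U V \<mu>.
       represented_by \<kappa>\<^sub>1 \<mu>\<^sub>1 \<longrightarrow> prob_space M \<longrightarrow> indep_rvs M U V \<longrightarrow>
       distr M borel U = \<mu>\<^sub>1 \<longrightarrow> distr M borel V = \<nu> \<longrightarrow>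
       \<mu> = distr M borel (\<lambda>\<omega>. U \<omega> *\<^sub>R V \<omega>) \<longrightarrow>
       (\<exists>k. (\<forall>x y. complex_of_real (k x y) = fourier_transform \<mu> (x - y)) \<and>
            bounded_measurable_kernel k \<and>
            (\<exists>\<Phi>. is_kernel_mean_embedding k P \<Phi> \<and>
                 (\<forall>x. integrated_h_depth \<kappa>\<^sub>1 \<nu> P x = \<kappa>\<^sub>1 0 * \<Phi> x))))"
proof (intro conjI allI impI)
  show "\<exists>\<mu>\<^sub>1. represented_by \<kappa>\<^sub>1 \<mu>\<^sub>1"
    using schoenberg[OF assms(8,4,6)] by blast
next
  fix \<mu>\<^sub>1 and M :: "'w measure" and U V \<mu>
  assume rep: "represented_by \<kappa>\<^sub>1 \<mu>\<^sub>1" and M: "prob_space M" and indep: "indep_rvs M U V"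
    and U: "distr M borel U = \<mu>\<^sub>1" and V: "distr M borel V = \<nu>"
    and \<mu>: "\<mu> = distr M borel (\<lambda>\<omega>. U \<omega> *\<^sub>R V \<omega>)"
  interpret P: prob_space P using assms(1) by (simp add: borel_prob_def)
  interpret \<nu>: prob_space \<nu> using assms(2) by (simp add: borel_prob_def)
  interpret P\<nu>: pair_prob_space P \<nu> ..
  have sets_P [measurable_cong]: "sets P = sets borel" and sets_\<nu> [measurable_cong]: "sets \<nu> = sets borel"
    using assms(1,2) by (auto simp: borel_prob_def)
  \<comment> \<open>The normalised even extension of \<open>\<kappa>\<^sub>1\<close> is continuous
    on the line, bounded by 1, and equal to the Fourier transform of
    \<open>\<mu>\<^sub>1\<close>.\<close>
  define f where "f t = \<kappa>\<^sub>1 \<bar>t\<bar> / \<kappa>\<^sub>1 0" for t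
  have f_cont: "continuous_on UNIV f"
    unfolding f_def using assms(6)
    by (intro continuous_intros continuous_on_compose2[OF assms(4)]) auto
  have f_lim: "((\<lambda>n. f (g n)) \<longlongrightarrow> f t) F" if "(g \<longlongrightarrow> t) F" for g t and F :: "nat filter"
    using continuous_on_tendsto_compose[OF f_cont that] by simp
  have f_bound: "norm (f t) \<le> 1" for t
    using assms(3)[of "\<bar>t\<bar>"] assms(6) monotone_onD[OF assms(5), of 0 "\<bar>t\<bar>"] by (simp add: f_def)
  have f_ft: "complex_of_real (f t) = fourier_transform \<mu>\<^sub>1 t" for t
  proof -
    have "complex_of_real (\<kappa>\<^sub>1 \<bar>t - 0\<bar>) = complex_of_real (\<kappa>\<^sub>1 0) * fourier_transform \<mu>\<^sub>1 (t - 0)"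
      using rep unfolding represented_by_def by blast
    thus ?thesis using assms(6) by (simp add: f_def)
  qed
  have fm: "(\<lambda>v. f (x \<bullet> v - y \<bullet> v)) \<in> borel_measurable borel" for x y :: 'a
    by (intro borel_measurable_continuous_onI continuous_on_compose2[OF f_cont] continuous_intros) auto
  have fm_\<nu>: "(\<lambda>v. f (x \<bullet> v - y \<bullet> v)) \<in> borel_measurable \<nu>" for x y :: 'a
    by (rule borel_measurable_borel_prob[OF assms(2) fm])
  obtain \<tau> :: "nat \<Rightarrow> 'a \<Rightarrow> 'a" where \<tau>: "\<And>n. simple_function borel (\<tau> n)"
    and \<tau>_\<nu>: "\<And>y. AE v in \<nu>. (\<lambda>n. \<tau> n y \<bullet> v) \<longlonglongrightarrow> y \<bullet> v"
    and \<tau>_P: "\<And>v. AE y in P. (\<lambda>n. \<tau> n y \<bullet> v) \<longlonglongrightarrow> y \<bullet> v"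
    using simple_weak_approximation[OF assms(1,2)] by blast
  have \<tau>_borel: "\<tau> n \<in> borel_measurable borel" for n
    by (rule measurable_compose[OF measurable_simple_function[OF \<tau>]]) simp
  \<comment> \<open>The kernel is introduced as a real integral over \<open>\<nu>\<close>;
    identifying it with the transform of \<open>\<mu>\<close> shows that the latter is real.\<close>
  define k where "k x y = (\<integral>v. f (x \<bullet> v - y \<bullet> v) \<partial>\<nu>)" for x y
  have k_ft: "complex_of_real (k x y) = fourier_transform \<mu> (x - y)" for x y
    unfolding \<mu> fourier_transform_scale_mixture[OF M indep] U V f_ft[symmetric] k_def
    by (simp add: inner_diff_left)
  have indep_meas: "U \<in> borel_measurable M" "V \<in> borel_measurable M"
    using indep by (auto simp: indep_rvs_def)
  have "borel_prob \<mu>"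
    unfolding borel_prob_def \<mu>
    using prob_space.prob_space_distr[OF M borel_measurable_scaleR_nonseparable[OF indep_meas]] by simp
  hence kernel: "is_kernel k" using k_ft by (rule fourier_kernel_pos_def)
  have k_bound: "\<bar>k x y\<bar> \<le> 1" for x y
  proof -
    have "norm (k x y) \<le> (\<integral>v. norm (f (x \<bullet> v - y \<bullet> v)) \<partial>\<nu>)" unfolding k_def by (rule integral_norm_bound)
    also have "\<dots> \<le> 1"
    proof (rule \<nu>.integral_le_const)
      show "integrable \<nu> (\<lambda>v. norm (f (x \<bullet> v - y \<bullet> v)))"
        by (intro integrable_norm \<nu>.integrable_const_bound[where B = 1] AE_I2 f_bound fm_\<nu>)
    qed (intro AE_I2 f_bound)
    finally show ?thesis by simp
  qed
  have k_diag: "k y y = 1" for y using assms(6) by (simp add: k_def f_def \<nu>.prob_space)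
  \<comment> \<open>Only the inner products with \<open>\<nu>\<close>-almost every \<open>v\<close>
    enter \<open>k\<close>, so the weak convergence of \<open>\<tau>\<close> and dominated
    convergence suffice.\<close>
  have k_lim: "(\<lambda>n. k (\<tau> n x) (\<tau> n y)) \<longlonglongrightarrow> k x y" "(\<lambda>n. k x (\<tau> n y)) \<longlonglongrightarrow> k x y" for x y
  proof -
    show "(\<lambda>n. k (\<tau> n x) (\<tau> n y)) \<longlonglongrightarrow> k x y"
      unfolding k_def
    proof (rule integral_dominated_convergence[where w = "\<lambda>_. 1"])
      show "AE v in \<nu>. (\<lambda>n. f (\<tau> n x \<bullet> v - \<tau> n y \<bullet> v)) \<longlonglongrightarrow> f (x \<bullet> v - y \<bullet> v)"
        using \<tau>_\<nu>[of x] \<tau>_\<nu>[of y] by eventually_elim (intro f_lim tendsto_diff)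
    qed (use fm_\<nu> f_bound in auto)
    show "(\<lambda>n. k x (\<tau> n y)) \<longlonglongrightarrow> k x y"
      unfolding k_def
    proof (rule integral_dominated_convergence[where w = "\<lambda>_. 1"])
      show "AE v in \<nu>. (\<lambda>n. f (x \<bullet> v - \<tau> n y \<bullet> v)) \<longlonglongrightarrow> f (x \<bullet> v - y \<bullet> v)"
        using \<tau>_\<nu>[of y] by eventually_elim (intro f_lim tendsto_diff tendsto_const)
    qed (use fm_\<nu> f_bound in auto)
  qed
  \<comment> \<open>The approximants depend on \<open>x\<close> and \<open>y\<close> through
    finitely many values each, hence are measurable for the product sigma-algebra.\<close>
  have k_meas: "(\<lambda>(x, y). k x y) \<in> borel_measurable (borel \<Otimes>\<^sub>M borel)"
  proof (rule borel_measurable_LIMSEQ_real)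
    show "(\<lambda>n. case p of (x, y) \<Rightarrow> k (\<tau> n x) (\<tau> n y)) \<longlonglongrightarrow> (case p of (x, y) \<Rightarrow> k x y)" for p
      using k_lim(1) by (cases p) simp
    show "(\<lambda>(x, y). k (\<tau> n x) (\<tau> n y)) \<in> borel_measurable (borel \<Otimes>\<^sub>M borel)" for n
    proof (rule measurable_simple_section[OF \<tau>])
      show "(\<lambda>y. k c (\<tau> n y)) \<in> borel_measurable borel" for c
        by (rule measurable_compose[OF measurable_simple_function[OF \<tau>]]) simp
    qed
  qed
  have k_meas2: "(\<lambda>y. k (g y) (h y)) \<in> borel_measurable P"
    if "g \<in> borel_measurable borel" "h \<in> borel_measurable borel" for g h
  proof -
    have "(\<lambda>y. (g y, h y)) \<in> measurable borel (borel \<Otimes>\<^sub>M borel)" using that by measurable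
    from measurable_compose[OF this k_meas] show ?thesis
      by (intro borel_measurable_borel_prob[OF assms(1)]) simp
  qed
  define \<Phi> where "\<Phi> = (\<lambda>x. \<integral>y. k x y \<partial>P)"
  have "has_bochner_integral_in (rkhs k) (rkhs_inner k) P (\<lambda>y x. k x y) (\<lambda>x. \<integral>y. k x y \<partial>P)"
  proof (rule has_bochner_integral_in_rkhs[OF kernel P.prob_space_axioms])
    show "simple_function P (\<tau> n)" for n
      using \<tau>[of n] sets_P by (simp add: simple_function_def sets_eq_imp_space_eq[OF sets_P])
    show "integrable P (k x)" for x
      by (rule P.integrable_const_bound[where B = 1]) (use k_bound in \<open>auto intro: k_meas2\<close>)
    show m: "(\<lambda>y. k y y - 2 * k y (\<tau> n y) + k (\<tau> n y) (\<tau> n y)) \<in> borel_measurable P" for n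
      by (intro borel_measurable_add borel_measurable_diff borel_measurable_times k_meas2 \<tau>_borel) auto
    show "(\<lambda>n. \<integral>\<^sup>+y. ennreal (sqrt (k y y - 2 * k y (\<tau> n y) + k (\<tau> n y) (\<tau> n y))) \<partial>P) \<longlonglongrightarrow> 0"
    proof -
      have "(\<lambda>n. \<integral>\<^sup>+y. ennreal (sqrt (k y y - 2 * k y (\<tau> n y) + k (\<tau> n y) (\<tau> n y))) \<partial>P) \<longlonglongrightarrow> (\<integral>\<^sup>+y. 0 \<partial>P)"
      \<comment> \<open>The distance of two kernel sections is at most 2 because \<open>k\<close> is
        bounded by 1, and it tends to 0 for every \<open>y\<close> because
        \<open>k y (\<tau> n y)\<close> tends to \<open>k y y = 1\<close>.\<close>
      proof (rule nn_integral_dominated_convergence[where w = "\<lambda>_. 2"])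
        show "(\<lambda>y. ennreal (sqrt (k y y - 2 * k y (\<tau> n y) + k (\<tau> n y) (\<tau> n y)))) \<in> borel_measurable P" for n
          using m[of n] by measurable
        show "AE y in P. ennreal (sqrt (k y y - 2 * k y (\<tau> n y) + k (\<tau> n y) (\<tau> n y))) \<le> 2" for n
        proof (rule AE_I2)
          fix y
          have "k y y - 2 * k y (\<tau> n y) + k (\<tau> n y) (\<tau> n y) \<le> 2\<^sup>2"
            using k_bound[of y "\<tau> n y"] k_diag by (simp add: abs_le_iff)
          hence "sqrt (k y y - 2 * k y (\<tau> n y) + k (\<tau> n y) (\<tau> n y)) \<le> 2" by (intro real_le_lsqrt) auto
          thus "ennreal (sqrt (k y y - 2 * k y (\<tau> n y) + k (\<tau> n y) (\<tau> n y))) \<le> 2"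
            by (metis ennreal_leI ennreal_numeral zero_le_numeral)
        qed
        show "AE y in P. (\<lambda>n. ennreal (sqrt (k y y - 2 * k y (\<tau> n y) + k (\<tau> n y) (\<tau> n y)))) \<longlonglongrightarrow> 0"
        proof (rule AE_I2)
          fix y
          have "(\<lambda>n. sqrt (k y y - 2 * k y (\<tau> n y) + k (\<tau> n y) (\<tau> n y))) \<longlonglongrightarrow> sqrt (1 - 2 * k y y + 1)"
            unfolding k_diag by (intro tendsto_intros k_lim(2)[of y y, unfolded k_diag])
          thus "(\<lambda>n. ennreal (sqrt (k y y - 2 * k y (\<tau> n y) + k (\<tau> n y) (\<tau> n y)))) \<longlonglongrightarrow> 0"
            using tendsto_ennrealI by (fastforce simp: k_diag)
        qed
      qed (auto simp: P.emeasure_space_1 ennreal_mult_less_top)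
      thus ?thesis by simp
    qed
  qed
  hence emb: "is_kernel_mean_embedding k P \<Phi>"
    unfolding is_kernel_mean_embedding_def \<Phi>_def using moore_aronszajn[OF kernel] by blast
  have depth: "integrated_h_depth \<kappa>\<^sub>1 \<nu> P x = \<kappa>\<^sub>1 0 * \<Phi> x" for x
  proof -
    \<comment> \<open>Fubini's theorem is applied to \<open>F n\<close>, whose joint measurability
      is available. One iterated integral converges by \<open>k_lim\<close>, the other by almost
      sure convergence under \<open>P\<close> for fixed \<open>v\<close>; equating the limits
      exchanges the integrals of the original integrand.\<close>
    define F where "F n y v = f (x \<bullet> v - \<tau> n y \<bullet> v)" for n y v
    have F_meas: "case_prod (F n) \<in> borel_measurable (P \<Otimes>\<^sub>M \<nu>)" for n
    proof -
      have "(\<lambda>(y, v). f (x \<bullet> v - \<tau> n y \<bullet> v)) \<in> borel_measurable (borel \<Otimes>\<^sub>M borel)"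
        by (rule measurable_simple_section[OF \<tau>, where f = "\<lambda>c v. f (x \<bullet> v - c \<bullet> v)"]) (rule fm)
      thus ?thesis unfolding F_def by (simp cong: measurable_cong_sets sets_pair_measure_cong add: sets_P sets_\<nu>)
    qed
    have F_int: "integrable (P \<Otimes>\<^sub>M \<nu>) (case_prod (F n))" for n
      by (rule P\<nu>.P.integrable_const_bound[where B = 1]) (use F_meas f_bound in \<open>auto simp: F_def\<close>)
    have F_\<nu>: "(\<lambda>n. \<integral>v. F n y v \<partial>\<nu>) \<longlonglongrightarrow> k x y" for y
      using k_lim(2)[of x y] by (simp add: F_def k_def)
    have F_P_meas: "(\<lambda>y. F n y v) \<in> borel_measurable P" for n v
      unfolding F_def
      by (intro borel_measurable_borel_prob[OF assms(1)] measurable_compose[OF measurable_simple_function[OF \<tau>]]) simp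
    have F_P: "(\<lambda>n. \<integral>y. F n y v \<partial>P) \<longlonglongrightarrow> (\<integral>y. f (x \<bullet> v - y \<bullet> v) \<partial>P)" for v
    proof (rule integral_dominated_convergence[where w = "\<lambda>_. 1"])
      show "(\<lambda>y. f (x \<bullet> v - y \<bullet> v)) \<in> borel_measurable P"
        by (intro borel_measurable_borel_prob[OF assms(1)] borel_measurable_continuous_onI
            continuous_on_compose2[OF f_cont] continuous_intros) auto
      show "AE y in P. (\<lambda>n. F n y v) \<longlonglongrightarrow> f (x \<bullet> v - y \<bullet> v)"
        using \<tau>_P[of v] by eventually_elim (auto simp: F_def intro!: f_lim tendsto_intros)
      show "AE y in P. norm (F n y v) \<le> 1" for n unfolding F_def by (intro AE_I2 f_bound)
    qed (auto intro: F_P_meas)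
    have bd\<nu>: "norm (\<integral>v. F n y v \<partial>\<nu>) \<le> 1" for n y
      using k_bound[of x "\<tau> n y"] by (simp add: F_def k_def)
    have bdP: "norm (\<integral>y. F n y v \<partial>P) \<le> 1" for n v
    proof -
      have "norm (\<integral>y. F n y v \<partial>P) \<le> (\<integral>y. norm (F n y v) \<partial>P)" by (rule integral_norm_bound)
      also have "\<dots> \<le> 1"
      proof (rule P.integral_le_const)
        show "integrable P (\<lambda>y. norm (F n y v))"
          by (intro integrable_norm P.integrable_const_bound[where B = 1] AE_I2 F_P_meas)
            (simp only: F_def f_bound)
      qed (simp only: F_def f_bound AE_I2)
      finally show ?thesis .
    qed
    have mP: "(\<lambda>y. \<integral>v. F n y v \<partial>\<nu>) \<in> borel_measurable P" for n
      using F_meas by (rule \<nu>.borel_measurable_lebesgue_integral)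
    have m\<nu>: "(\<lambda>v. \<integral>y. F n y v \<partial>P) \<in> borel_measurable \<nu>" for n
      using measurable_pair_swap[OF F_meas[of n]]
      by (intro P.borel_measurable_lebesgue_integral) simp
    have 1: "(\<lambda>n. \<integral>y. (\<integral>v. F n y v \<partial>\<nu>) \<partial>P) \<longlonglongrightarrow> \<Phi> x"
      unfolding \<Phi>_def
      by (rule integral_dominated_convergence[where w = "\<lambda>_. 1"])
        (use borel_measurable_LIMSEQ_real[OF F_\<nu> mP] mP F_\<nu> bd\<nu> in auto)
    have 2: "(\<lambda>n. \<integral>v. (\<integral>y. F n y v \<partial>P) \<partial>\<nu>) \<longlonglongrightarrow> (\<integral>v. (\<integral>y. f (x \<bullet> v - y \<bullet> v) \<partial>P) \<partial>\<nu>)"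
      by (rule integral_dominated_convergence[where w = "\<lambda>_. 1"])
        (use borel_measurable_LIMSEQ_real[OF F_P m\<nu>] m\<nu> F_P bdP in auto)
    have "(\<integral>v. (\<integral>y. F n y v \<partial>P) \<partial>\<nu>) = (\<integral>y. (\<integral>v. F n y v \<partial>\<nu>) \<partial>P)" for n
      by (rule P\<nu>.Fubini_integral[OF F_int])
    with 1 2 have "(\<integral>v. (\<integral>y. f (x \<bullet> v - y \<bullet> v) \<partial>P) \<partial>\<nu>) = \<Phi> x"
      using LIMSEQ_unique by simp
    thus ?thesis using assms(6) by (simp add: integrated_h_depth_def f_def field_simps)
  qed
  show "\<exists>k. (\<forall>x y. complex_of_real (k x y) = fourier_transform \<mu> (x - y)) \<and>
      bounded_measurable_kernel k \<and>
      (\<exists>\<Phi>. is_kernel_mean_embedding k P \<Phi> \<and> (\<forall>x. integrated_h_depth \<kappa>\<^sub>1 \<nu> P x = \<kappa>\<^sub>1 0 * \<Phi> x))"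
    using k_ft kernel k_bound k_meas emb depth
    by (intro exI[of _ k] conjI exI[of _ \<Phi>]) (auto simp: bounded_measurable_kernel_def)
qed

end
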